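(* Let $n\ge 6$ be an integer. Then $$ex(n,\mathscr{F}_{n-2})=\frac{n(n-1)}{2}-1.$$ Moreover, a digraph $D$ is in $Ex(n,\mathscr{F}_{n-2})$ if and only if its adjacency matrix $A_D$ is permutation similar to $$K_n=\begin{bmatrix} T_{n-2}&J_{n-2,2}\\ 0&0\end{bmatrix}\quad\text{or}\quad K_n'=\begin{bmatrix} 0&J_{2,n-2}\\ 0&T_{n-2}\end{bmatrix}.$$
   Context: Digraphs here have no parallel arcs but may have loops (a loop counts as an arc). A walk of length $k$ from $u$ to $v$ is a sequence of vertices $u=v_0,\dots,v_k=v$ with each $(v_{i-1},v_i)$ an arc. A digraph is $\mathscr{F}_k$-free if for every ordered pair of vertices $(i,j)$ there is at most one walk of length $k$ from $i$ to $j$. $ex(n,\mathscr{F}_k)$ is the maximum number of arcs of an $\mathscr{F}_k$-free digraph of order $n$ (loops allowed), and $Ex(n,\mathscr{F}_k)$ is the set of $\mathscr{F}_k$-free digraphs of order $n$ attaining this maximum. $A_D=(a_{ij})$ is the adjacency matrix ($a_{ij}=1$ iff $(v_i,v_j)$ is an arc). Matrices $A,B$ are permutation similar if $B=PAP^T$ for a permutation matrix $P$. $T_m$ is the $m\times m$ matrix with $(i,j)$-entry $1$ if $i<j$ and $0$ otherwise; $J_{a,b}$ is the $a\times b$ all-ones matrix; blocks $0$ are zero matrices. *)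

theory Defs
  imports Complex_Main "Graph_Theory.Graph_Theory" "Jordan_Normal_Form.Matrix"
begin

text \<open>
  Digraphs are finite \<^typ>\<open>'a pair_pre_digraph\<close>s satisfying \<^const>\<open>pair_fin_digraph\<close>: arcs are
  ordered pairs of vertices, so there are no parallel arcs, while loops are allowed.
\<close>

definition walk_of_length :: "'a pair_pre_digraph \<Rightarrow> nat \<Rightarrow> 'a \<Rightarrow> 'a \<Rightarrow> 'a list \<Rightarrow> bool" where
  "walk_of_length D k u v p \<longleftrightarrow>
     vwalk p (with_proj D) \<and> vwalk_length p = k \<and> hd p = u \<and> last p = v"

definition F_free :: "nat \<Rightarrow> 'a pair_pre_digraph \<Rightarrow> bool" where
  "F_free k D \<longleftrightarrow>
     (\<forall>u \<in> pverts D. \<forall>v \<in> pverts D. \<forall>p q.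
        walk_of_length D k u v p \<and> walk_of_length D k u v q \<longrightarrow> p = q)"

definition F_free_digraphs :: "nat \<Rightarrow> nat \<Rightarrow> 'a pair_pre_digraph set" where
  "F_free_digraphs n k = {D. pair_fin_digraph D \<and> card (pverts D) = n \<and> F_free k D}"

text \<open>
  The extremal number does not depend on the names of the vertices. It is defined with vertices
  in \<^typ>\<open>nat\<close>, which has enough elements for every order \<open>n\<close>; \<open>Ex_F\<close> allows any vertex type.
\<close>

definition ex_F :: "nat \<Rightarrow> nat \<Rightarrow> nat" where
  "ex_F n k = Max ((\<lambda>D. card (parcs D)) ` (F_free_digraphs n k :: nat pair_pre_digraph set))"

definition Ex_F :: "nat \<Rightarrow> nat \<Rightarrow> 'a pair_pre_digraph set" where
  "Ex_F n k = {D \<in> F_free_digraphs n k. card (parcs D) = ex_F n k}"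

text \<open>The list \<open>vs\<close> enumerates the vertices and fixes the order of rows and columns.\<close>

definition adjacency_mat :: "'a list \<Rightarrow> 'a pair_pre_digraph \<Rightarrow> int mat" where
  "adjacency_mat vs D =
     mat (length vs) (length vs) (\<lambda>(i, j). if (vs ! i, vs ! j) \<in> parcs D then 1 else 0)"

definition permutation_mat :: "nat \<Rightarrow> (nat \<Rightarrow> nat) \<Rightarrow> int mat" where
  "permutation_mat n \<sigma> = mat n n (\<lambda>(i, j). if j = \<sigma> i then 1 else 0)"

definition permutation_similar :: "int mat \<Rightarrow> int mat \<Rightarrow> bool" where
  "permutation_similar A B \<longleftrightarrow>
     square_mat A \<and>
     (\<exists>\<sigma>. \<sigma> permutes {..<dim_row A} \<and>
        B = permutation_mat (dim_row A) \<sigma> * A * transpose_mat (permutation_mat (dim_row A) \<sigma>))"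

definition T_mat :: "nat \<Rightarrow> int mat" where
  "T_mat m = mat m m (\<lambda>(i, j). if i < j then 1 else 0)"

definition J_mat :: "nat \<Rightarrow> nat \<Rightarrow> int mat" where
  "J_mat a b = mat a b (\<lambda>_. 1)"

definition K_mat :: "nat \<Rightarrow> int mat" where
  "K_mat n = four_block_mat (T_mat (n - 2)) (J_mat (n - 2) 2) (0\<^sub>m 2 (n - 2)) (0\<^sub>m 2 2)"

definition K'_mat :: "nat \<Rightarrow> int mat" where
  "K'_mat n = four_block_mat (0\<^sub>m 2 2) (J_mat 2 (n - 2)) (0\<^sub>m (n - 2) 2) (T_mat (n - 2))"

end

theory Submission
  imports Defs "HOL-Combinatorics.Permutations"
begin

text \<open>
  On \<open>n\<close> vertices, twice the number of arcs is \<open>n (n - 1) + 2 l + d - m\<close>, where \<open>l\<close> is the number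
  of loops and \<open>d\<close>, \<open>m\<close> count the ordered pairs of distinct vertices joined in both directions and
  not joined at all. Two distinct walks with the same length and endpoints can be prolonged at a
  vertex of a cycle, so for \<open>k = n - 2\<close> the short walks near a cycle are already unique. Hence all loops and digons are
  pairwise nonadjacent, and the out-neighbours (and likewise the in-neighbours) of a short cycle
  are almost independent. This gives \<open>m \<ge> 2 l + d + 4\<close> as soon as there is a cycle: start from a
  digon, else a loop, else a triangle; a shortest cycle of length at least four has two chords missing.
  Thus an extremal digraph is a transitive tournament minus at most one arc, and
  comparing the walks that omit a single inner vertex shows that the missing arc
  joins the first two or the last two vertices.
\<close>

section \<open>Walks that are determined by length and endpoints\<close>

text \<open>Walks are vertex lists, so a walk of length \<open>k\<close> has \<open>Suc k\<close>
  entries. No vertex set occurs here; \<open>F_free_iff_unique_walks\<close> brings it back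
  in.\<close>

definition arc_walk :: "('a \<times> 'a) set \<Rightarrow> 'a list \<Rightarrow> bool" where
  "arc_walk E p \<longleftrightarrow> p \<noteq> [] \<and> successively (\<lambda>x y. (x, y) \<in> E) p"

lemma arc_walk_Cons:
  "p \<noteq> [] \<Longrightarrow> arc_walk E (x # p) \<longleftrightarrow> (x, hd p) \<in> E \<and> arc_walk E p"
  by (auto simp: arc_walk_def successively_Cons)

lemma arc_walk_snoc:
  "p \<noteq> [] \<Longrightarrow> arc_walk E (p @ [x]) \<longleftrightarrow> (last p, x) \<in> E \<and> arc_walk E p"
  by (auto simp: arc_walk_def successively_append_iff)

text \<open>In the applications \<open>S\<close> is a digon, a triangle or a pair of loop vertices,
  where a walk can linger as long as required.\<close>

lemma arc_walk_within:
  assumes "\<forall>s\<in>S. \<exists>t\<in>S. (s, t) \<in> E" and "s \<in> S"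
  shows "\<exists>p. arc_walk E p \<and> length p = Suc j \<and> hd p = s \<and> last p \<in> S"
proof (induction j)
  case 0
  show ?case using assms(2) by (intro exI[of _ "[s]"]) (auto simp: arc_walk_def)
next
  case (Suc j)
  then obtain p where p: "arc_walk E p" "length p = Suc j" "hd p = s" "last p \<in> S" by blast
  then obtain t where "t \<in> S" "(last p, t) \<in> E" using assms(1) by blast
  moreover have "p \<noteq> []" using p(2) by auto
  ultimately show ?case using p by (intro exI[of _ "p @ [t]"]) (simp add: arc_walk_snoc)
qed

locale unique_walks =
  fixes E :: "('a \<times> 'a) set" and k :: nat
  assumes unique: "\<lbrakk>arc_walk E p; arc_walk E q; length p = Suc k; length q = Suc k;
    hd p = hd q; last p = last q\<rbrakk> \<Longrightarrow> p = q"
begin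

text \<open>Both walks can be extended backwards by the same predecessor inside \<open>S\<close>,
  one vertex at a time, until they have length \<open>k\<close>. Uniqueness thus passes down to
  shorter walks that start in \<open>S\<close>.\<close>

lemma backward_unique:
  assumes S: "\<forall>s\<in>S. \<exists>t\<in>S. (t, s) \<in> E"
    and "arc_walk E p" "arc_walk E q" "length p = length q" "length q \<le> Suc k"
    and "hd p = hd q" "last p = last q" "hd q \<in> S"
  shows "p = q"
proof -
  \<comment> \<open>\<open>d\<close> is the number of vertices still to be prepended.\<close>
  have "\<lbrakk>length q + d = Suc k; arc_walk E p; arc_walk E q; length p = length q;
      hd p = hd q; last p = last q; hd q \<in> S\<rbrakk> \<Longrightarrow> p = q" for d p q
  proof (induction d arbitrary: p q)
    case 0
    then show ?case by (intro unique) simp_all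
  next
    case (Suc d)
    from S Suc.prems(7) obtain t where t: "t \<in> S" "(t, hd q) \<in> E" by blast
    have ne: "p \<noteq> []" "q \<noteq> []" using Suc.prems(2,3) by (simp_all add: arc_walk_def)
    have "t # p = t # q"
      by (rule Suc.IH) (use Suc.prems t ne in \<open>simp_all add: arc_walk_Cons\<close>)
    then show ?case by simp
  qed
  from this[of q "Suc k - length q" p] show ?thesis using assms(2-) by simp
qed

lemma forward_unique:
  assumes S: "\<forall>s\<in>S. \<exists>t\<in>S. (s, t) \<in> E"
    and "arc_walk E p" "arc_walk E q" "length p = length q" "length q \<le> Suc k"
    and "hd p = hd q" "last p = last q" "last q \<in> S"
  shows "p = q"
proof -
  have "\<lbrakk>length q + d = Suc k; arc_walk E p; arc_walk E q; length p = length q;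
      hd p = hd q; last p = last q; last q \<in> S\<rbrakk> \<Longrightarrow> p = q" for d p q
  proof (induction d arbitrary: p q)
    case 0
    then show ?case by (intro unique) simp_all
  next
    case (Suc d)
    from S Suc.prems(7) obtain t where t: "t \<in> S" "(last q, t) \<in> E" by blast
    have ne: "p \<noteq> []" "q \<noteq> []" using Suc.prems(2,3) by (simp_all add: arc_walk_def)
    have "p @ [t] = q @ [t]"
      by (rule Suc.IH) (use Suc.prems t ne in \<open>simp_all add: arc_walk_snoc\<close>)
    then show ?case by simp
  qed
  from this[of q "Suc k - length q" p] show ?thesis using assms(2-) by simp
qed

lemma diamond_from:
  assumes "\<forall>s\<in>S. \<exists>t\<in>S. (t, s) \<in> E" and "x \<in> S" and "2 \<le> k"
    and "(x, a) \<in> E" "(a, y) \<in> E" "(x, b) \<in> E" "(b, y) \<in> E"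
  shows "a = b"
  using backward_unique[OF assms(1), of "[x, a, y]" "[x, b, y]"] assms(2-)
  by (simp add: arc_walk_def)

lemma diamond_to:
  assumes "\<forall>s\<in>S. \<exists>t\<in>S. (s, t) \<in> E" and "y \<in> S" and "2 \<le> k"
    and "(x, a) \<in> E" "(a, y) \<in> E" "(x, b) \<in> E" "(b, y) \<in> E"
  shows "a = b"
  using forward_unique[OF assms(1), of "[x, a, y]" "[x, b, y]"] assms(2-)
  by (simp add: arc_walk_def)

text \<open>A walk from \<open>x\<close> to \<open>w\<close> may enter \<open>S\<close> at
  \<open>s\<close> or at \<open>t\<close>, spend \<open>k - 2\<close> arcs inside \<open>S\<close>
  and leave to \<open>w\<close> from wherever it stands. Its length is exactly \<open>k\<close>, and
  its second vertex reveals the entrance.\<close>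

lemma through_unique:
  assumes "\<forall>s\<in>S. \<exists>t\<in>S. (s, t) \<in> E" and "2 \<le> k" and "\<forall>s\<in>S. (s, w) \<in> E"
    and "s \<in> S" "t \<in> S" "(x, s) \<in> E" "(x, t) \<in> E"
  shows "s = t"
proof -
  obtain p where p: "arc_walk E p" "length p = Suc (k - 2)" "hd p = s" "last p \<in> S"
    using arc_walk_within[OF assms(1,4)] by blast
  obtain q where q: "arc_walk E q" "length q = Suc (k - 2)" "hd q = t" "last q \<in> S"
    using arc_walk_within[OF assms(1,5)] by blast
  have ne: "p \<noteq> []" "q \<noteq> []" using p(2) q(2) by auto
  have "(last p, w) \<in> E" "(last q, w) \<in> E" using assms(3) p(4) q(4) by auto
  then have "x # p @ [w] = x # q @ [w]"
    using p(1-3) q(1-3) ne assms(2,6,7)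
    by (intro unique) (simp_all add: arc_walk_Cons arc_walk_snoc)
  then show ?thesis using p(3) q(3) by simp
qed

end

section \<open>Short cycles cost adjacencies\<close>

text \<open>Ordered pairs, so each missing adjacency counts twice, just as each digon does in
  \<open>digons\<close>. This keeps \<open>arcs_count\<close> free of halves.\<close>

definition nonadjacent :: "'a set \<Rightarrow> ('a \<times> 'a) set \<Rightarrow> ('a \<times> 'a) set" where
  "nonadjacent V E = {(x, y). x \<in> V \<and> y \<in> V \<and> x \<noteq> y \<and> (x, y) \<notin> E \<and> (y, x) \<notin> E}"

definition loop_vertices :: "('a \<times> 'a) set \<Rightarrow> 'a set" where
  "loop_vertices E = {v. (v, v) \<in> E}"

definition digons :: "('a \<times> 'a) set \<Rightarrow> ('a \<times> 'a) set" where
  "digons E = {(x, y). x \<noteq> y \<and> (x, y) \<in> E \<and> (y, x) \<in> E}"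

lemma finite_nonadjacent: "finite V \<Longrightarrow> finite (nonadjacent V E)"
  by (rule finite_subset[of _ "V \<times> V"]) (auto simp: nonadjacent_def)

lemma card_eq_disjoint_union:
  "\<lbrakk>C = A \<union> B; A \<inter> B = {}; finite C\<rbrakk> \<Longrightarrow> card C = card A + card B"
  by (simp add: card_Un_disjoint)

lemma card_off_diagonal:
  assumes "finite F"
  shows "card (F \<times> F - Id) + card F = card F * card F"
proof -
  have "card (F \<times> F) = card (F \<times> F - Id) + card ((\<lambda>x. (x, x)) ` F)"
    using assms by (intro card_eq_disjoint_union) auto
  also have "card ((\<lambda>x. (x, x)) ` F) = card F" by (intro card_image) (auto simp: inj_on_def)
  finally show ?thesis by (simp add: card_cartesian_product)
qed

text \<open>This is \<open>(m - 1) * (m - 2) \<ge> 0\<close> for \<open>m = card F\<close>. It gives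
  a linear bound for the missing pairs inside an independent set \<open>F\<close>.\<close>

lemma card_off_diagonal_ge:
  assumes "finite F"
  shows "2 * card F \<le> card (F \<times> F - Id) + 2"
proof -
  have "3 * m \<le> m * m + 2" for m :: nat
    by (cases m; cases "m - 1") (auto simp: algebra_simps)
  from this[of "card F"] show ?thesis using card_off_diagonal[OF assms] by linarith
qed

text \<open>Without loops, \<open>E\<close> and its converse meet in the digons, and their union
  together with the nonadjacent pairs makes up all off-diagonal pairs.\<close>

lemma arcs_count:
  assumes "finite V" and "E \<subseteq> V \<times> V"
  shows "2 * card E + card (nonadjacent V E) + card V
    = card V * card V + 2 * card (loop_vertices E) + card (digons E)"
proof -
  define E0 where "E0 = E - Id"
  have fin: "finite E" using assms finite_subset by blast
  then have fin0: "finite E0" "finite (E0\<inverse>)" by (auto simp: E0_def)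
  have "card E = card E0 + card ((\<lambda>x. (x, x)) ` loop_vertices E)"
    using fin by (intro card_eq_disjoint_union) (auto simp: E0_def loop_vertices_def)
  also have "card ((\<lambda>x. (x, x)) ` loop_vertices E) = card (loop_vertices E)"
    by (intro card_image) (auto simp: inj_on_def)
  finally have 1: "card E = card E0 + card (loop_vertices E)" .
  have "E0 \<inter> E0\<inverse> = digons E" by (auto simp: E0_def digons_def)
  then have 2: "card E0 + card (E0\<inverse>) = card (E0 \<union> E0\<inverse>) + card (digons E)"
    using card_Un_Int[OF fin0] by simp
  have 3: "card (V \<times> V - Id) = card (E0 \<union> E0\<inverse>) + card (nonadjacent V E)"
    using assms by (intro card_eq_disjoint_union) (auto simp: E0_def nonadjacent_def)
  show ?thesis using 1 2 3 card_off_diagonal[OF assms(1)] card_inverse[of E0] by linarith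
qed

section \<open>Digons\<close>

context unique_walks
begin

context
  assumes k: "4 \<le> k"
begin

text \<open>Five vertices are length four, which \<open>digon_partner\<close> and
  \<open>digon_no_detour\<close> need in full. With \<open>k = n - 2\<close> this asks for
  \<open>n \<ge> 6\<close>.\<close>

lemma digon_walks:
  assumes "(a, b) \<in> E" "(b, a) \<in> E" and "arc_walk E p" "arc_walk E q"
    and "length p = length q" "length q \<le> 5" "hd p = a" "hd q = a" "last p = last q"
  shows "p = q"
proof -
  have "\<forall>s\<in>{a, b}. \<exists>t\<in>{a, b}. (t, s) \<in> E" using assms(1,2) by blast
  then show ?thesis by (rule backward_unique) (use assms k in simp_all)
qed

lemma loop_walks:
  assumes "(v, v) \<in> E" and "arc_walk E p" "arc_walk E q"
    and "length p = length q" "length q \<le> 5" "hd p = v" "hd q = v" "last p = last q"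
  shows "p = q"
proof -
  have "\<forall>s\<in>{v}. \<exists>t\<in>{v}. (t, s) \<in> E" using assms(1) by blast
  then show ?thesis by (rule backward_unique) (use assms k in simp_all)
qed

lemma digon_no_loop:
  assumes "(a, b) \<in> E" "(b, a) \<in> E" "a \<noteq> b"
  shows "(a, a) \<notin> E"
  using digon_walks[OF assms(1,2), of "[a, a, b, a]" "[a, b, a, a]"] assms
  by (auto simp: arc_walk_def)

text \<open>Two digons at \<open>a\<close> could be traversed in either order.\<close>

lemma digon_partner:
  assumes "(a, b) \<in> E" "(b, a) \<in> E" "(a, c) \<in> E" "(c, a) \<in> E"
  shows "b = c"
proof -
  have "[a, b, a, c, a] = [a, c, a, b, a]"
    by (rule digon_walks[OF assms(1,2)]) (use assms in \<open>simp_all add: arc_walk_def\<close>)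
  from arg_cong[OF this, of "\<lambda>p. p ! 1"] show ?thesis by simp
qed

text \<open>The competing walks spend their spare arcs either on the loop or on the digon.\<close>

lemma loop_digon_nonadjacent:
  assumes "(v, v) \<in> E" "(a, b) \<in> E" "(b, a) \<in> E" "a \<noteq> b"
  shows "(v, a) \<notin> E" "(a, v) \<notin> E"
  using loop_walks[OF assms(1), of "[v, v, v, a]" "[v, a, b, a]"]
    digon_walks[OF assms(2,3), of "[a, b, a, v]" "[a, v, v, v]"] assms
  by (auto simp: arc_walk_def)

lemma digons_nonadjacent:
  assumes "(a, b) \<in> E" "(b, a) \<in> E" "(c, d) \<in> E" "(d, c) \<in> E" "a \<noteq> d"
  shows "(a, c) \<notin> E"
  using digon_walks[OF assms(1,2), of "[a, b, a, c]" "[a, c, d, c]"] assms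
  by (auto simp: arc_walk_def)

text \<open>The detour via \<open>w\<close> and the turn around the digon could be made in either
  order.\<close>

lemma digon_no_detour:
  assumes "(a, b) \<in> E" "(b, a) \<in> E" "a \<noteq> b" "(a, w) \<in> E"
  shows "(w, b) \<notin> E"
proof
  assume "(w, b) \<in> E"
  then have "[a, w, b, a, b] = [a, b, a, w, b]"
    by (intro digon_walks[OF assms(1,2)]) (use assms in \<open>simp_all add: arc_walk_def\<close>)
  from arg_cong[OF this, of "\<lambda>p. p ! 2"] show False using assms(3) by simp
qed

lemma digon_one_way:
  assumes "(a, b) \<in> E" "(b, a) \<in> E" "a \<noteq> b" "w \<noteq> a" "w \<noteq> b"
    and "(a, w) \<in> E \<or> (w, a) \<in> E" "(b, w) \<in> E \<or> (w, b) \<in> E"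
  shows "(a, w) \<in> E \<and> (b, w) \<in> E \<or> (w, a) \<in> E \<and> (w, b) \<in> E"
  using digon_no_detour[of a b w] digon_no_detour[of b a w] assms by blast

text \<open>An arc between two out-neighbours of the digon gives a diamond starting on it, one
  between two in-neighbours a diamond ending on it. An in-neighbour and an out-neighbour cannot
  coexist, since walks may enter the digon at either vertex.\<close>

lemma digon_neighbours_independent:
  assumes ab: "(a, b) \<in> E" "(b, a) \<in> E" "a \<noteq> b"
    and w: "w \<noteq> a" "w \<noteq> b" "(a, w) \<in> E \<or> (w, a) \<in> E" "(b, w) \<in> E \<or> (w, b) \<in> E"
    and w': "w' \<noteq> a" "w' \<noteq> b" "(a, w') \<in> E \<or> (w', a) \<in> E" "(b, w') \<in> E \<or> (w', b) \<in> E"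
  shows "(w, w') \<notin> E"
proof
  assume ww: "(w, w') \<in> E"
  have S: "\<forall>s\<in>{a, b}. \<exists>t\<in>{a, b}. (t, s) \<in> E" "\<forall>s\<in>{a, b}. \<exists>t\<in>{a, b}. (s, t) \<in> E"
    using ab by auto
  consider "(a, w) \<in> E" "(a, w') \<in> E" "(b, w') \<in> E"
    | "(w, a) \<in> E" "(w', a) \<in> E" "(w', b) \<in> E"
    | "(a, w) \<in> E" "(b, w) \<in> E" "(w', a) \<in> E" "(w', b) \<in> E"
    | "(w, a) \<in> E" "(w, b) \<in> E" "(a, w') \<in> E" "(b, w') \<in> E"
    using digon_one_way[OF ab w] digon_one_way[OF ab w'] by blast
  then show False
  proof cases
    case 1
    then show False using diamond_from[OF S(1), of a w w' b] ab ww w k by auto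
  next
    case 2
    then show False using diamond_to[OF S(2), of b w w' a] ab ww w' k by auto
  next
    case 3
    then show False using through_unique[OF S(2), of w a b w'] ab k by auto
  next
    case 4
    then show False using through_unique[OF S(2), of w' a b w] ab k by auto
  qed
qed

text \<open>Fix a digon \<open>a\<close>, \<open>b\<close>. Vertices of \<open>Y\<close> are
  nonadjacent to both ends, vertices of \<open>Z\<close> to at least one, and the common neighbours
  \<open>F\<close> are independent. Since \<open>card Y + 2 = l + d\<close> and there are
  \<open>2 + card Y + card Z + card F \<ge> 6\<close> vertices, this yields at least
  \<open>2 l + 2 d + 2\<close> ordered pairs, which suffices as \<open>d \<ge> 2\<close>.\<close>

lemma digon_deficit:
  assumes V: "finite V" "E \<subseteq> V \<times> V" "6 \<le> card V" and ne: "digons E \<noteq> {}"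
  shows "2 * card (loop_vertices E) + card (digons E) + 4 \<le> card (nonadjacent V E)"
proof -
  obtain a b where ab: "(a, b) \<in> E" "(b, a) \<in> E" "a \<noteq> b" using ne by (auto simp: digons_def)
  define L where "L = loop_vertices E"
  define B where "B = fst ` digons E"
  define Y where "Y = (L \<union> B) - {a, b}"
  define F where "F = {w \<in> V - {a, b}. ((a, w) \<in> E \<or> (w, a) \<in> E) \<and> ((b, w) \<in> E \<or> (w, b) \<in> E)}"
  define Z where "Z = V - {a, b} - Y - F"
  \<comment> \<open>For \<open>w\<close> in \<open>Z\<close>, this is an end of the digon that is
    nonadjacent to \<open>w\<close>.\<close>
  define h where "h w = (if (a, w) \<in> E \<or> (w, a) \<in> E then b else a)" for w
  have LV: "L \<subseteq> V" and BV: "B \<subseteq> V"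
    using V(2) by (auto simp: L_def B_def loop_vertices_def digons_def)
  have abV: "a \<in> V" "b \<in> V" using V(2) ab by auto
  have fin: "finite L" "finite B" using LV BV V(1) finite_subset by auto
  have fin': "finite Y" "finite F" "finite Z" using fin V(1) by (auto simp: Y_def F_def Z_def)
  \<comment> \<open>Each vertex lies on at most one digon, so \<open>digons E\<close> can be counted
    by first components.\<close>
  have "inj_on fst (digons E)"
    by (auto simp: inj_on_def digons_def intro: digon_partner)
  then have cB: "card (digons E) = card B" by (simp add: B_def card_image)
  have abB: "{a, b} \<subseteq> B" using ab by (force simp: B_def digons_def)
  have LB: "L \<inter> B = {}"
    using digon_no_loop by (auto simp: L_def B_def loop_vertices_def digons_def)
  have "card (L \<union> B) = card L + card B" using LB fin by (simp add: card_Un_disjoint)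
  then have cY: "card Y + 2 = card L + card B"
    using abB ab fin card_Diff_subset[of "{a, b}" "L \<union> B"] card_mono[of "L \<union> B" "{a, b}"]
    by (auto simp: Y_def)
  have Yna: "y \<noteq> a \<and> y \<noteq> b \<and> (a, y) \<notin> E \<and> (y, a) \<notin> E \<and> (b, y) \<notin> E \<and> (y, b) \<notin> E"
    if y: "y \<in> Y" for y
  proof (cases "y \<in> L")
    case True
    then show ?thesis
      using y loop_digon_nonadjacent[of y a b] loop_digon_nonadjacent[of y b a] ab
      by (auto simp: L_def Y_def loop_vertices_def)
  next
    case False
    then obtain z where z: "(y, z) \<in> E" "(z, y) \<in> E" "y \<noteq> z" "y \<noteq> a" "y \<noteq> b"
      using y by (auto simp: Y_def B_def digons_def)
    moreover have "z \<noteq> a" "z \<noteq> b"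
      using z ab digon_partner[of a b y] digon_partner[of b a y] by auto
    ultimately show ?thesis
      using digons_nonadjacent[of a b y z] digons_nonadjacent[of y z a b]
        digons_nonadjacent[of b a y z] digons_nonadjacent[of y z b a] ab by auto
  qed
  have YF: "Y \<inter> F = {}" using Yna by (auto simp: F_def)
  have ZF: "Z \<inter> F = {}" and YZF: "Y \<inter> (Z \<union> F) = {}" using YF by (auto simp: Z_def)
  have YV: "Y \<subseteq> V" using LV BV by (auto simp: Y_def)
  have "V = {a, b} \<union> (Y \<union> (Z \<union> F))" "{a, b} \<inter> (Y \<union> (Z \<union> F)) = {}"
    using YV abV Yna by (auto simp: Z_def F_def)
  then have "card V = card {a, b} + card (Y \<union> (Z \<union> F))"
    using V(1) by (intro card_eq_disjoint_union)
  moreover have "card (Y \<union> (Z \<union> F)) = card Y + card (Z \<union> F)" "card (Z \<union> F) = card Z + card F"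
    using fin' YZF ZF by (simp_all add: card_Un_disjoint)
  ultimately have cV: "card V = 2 + card Y + card Z + card F" using ab by simp
  \<comment> \<open>Missing pairs pointing to the digon. First components avoid \<open>F\<close> and
    second components lie in \<open>{a, b}\<close>, so \<open>A\<close>, its converse and the pairs
    inside \<open>F\<close> are pairwise disjoint.\<close>
  define A where "A = Y \<times> {a, b} \<union> (\<lambda>z. (z, h z)) ` Z"
  have "card A = card (Y \<times> {a, b}) + card ((\<lambda>z. (z, h z)) ` Z)"
    using fin' by (intro card_eq_disjoint_union) (auto simp: A_def Z_def)
  moreover have "card ((\<lambda>z. (z, h z)) ` Z) = card Z" by (intro card_image) (auto simp: inj_on_def)
  ultimately have cA: "card A = 2 * card Y + card Z" using ab by (simp add: card_cartesian_product)
  have finA: "finite A" using fin' by (simp add: A_def)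
  have h: "h z \<in> {a, b} \<and> (z, h z) \<notin> E \<and> (h z, z) \<notin> E \<and> z \<in> V - {a, b} - F" if "z \<in> Z" for z
    using that by (auto simp: Z_def F_def h_def)
  have A_sub: "A \<subseteq> (V - {a, b} - F) \<times> {a, b}"
    using YV YF Yna h unfolding A_def by blast
  have "(y, c) \<in> nonadjacent V E" if "y \<in> Y" "c \<in> {a, b}" for y c
    using that YV Yna[OF that(1)] abV by (auto simp: nonadjacent_def)
  moreover have "(z, h z) \<in> nonadjacent V E" if "z \<in> Z" for z
    using h[OF that] abV by (auto simp: nonadjacent_def)
  ultimately have AN: "A \<subseteq> nonadjacent V E" unfolding A_def by blast
  then have "A\<inverse> \<subseteq> nonadjacent V E" by (auto simp: nonadjacent_def)
  moreover have "F \<times> F - Id \<subseteq> nonadjacent V E"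
    using digon_neighbours_independent[OF ab] by (auto simp: F_def nonadjacent_def)
  moreover have "finite (nonadjacent V E)" using V(1) by (rule finite_nonadjacent)
  ultimately have "card (A \<union> (A\<inverse> \<union> (F \<times> F - Id))) \<le> card (nonadjacent V E)"
    using AN by (intro card_mono) auto
  moreover have "card (A \<union> (A\<inverse> \<union> (F \<times> F - Id))) = card A + card (A\<inverse> \<union> (F \<times> F - Id))"
    using A_sub finA fin' by (intro card_Un_disjoint) auto
  moreover have "card (A\<inverse> \<union> (F \<times> F - Id)) = card (A\<inverse>) + card (F \<times> F - Id)"
    using A_sub finA fin' by (intro card_Un_disjoint) auto
  moreover have "card (A\<inverse>) = card A" by simp
  moreover have "2 \<le> card B" using abB fin(2) ab card_mono[of B "{a, b}"] by simp
  ultimately show ?thesis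
    using card_off_diagonal_ge[OF fin'(2)] cA cV cY V(3) cB unfolding L_def[symmetric] by linarith
qed

section \<open>Loops\<close>

lemma loops_nonadjacent:
  assumes "(v, v) \<in> E" "(v', v') \<in> E" "v \<noteq> v'"
  shows "(v, v') \<notin> E"
  using diamond_from[of "{v}" v v v' v'] assms k by auto

text \<open>A loop could be turned before or after passing \<open>w\<close>. The case
  \<open>v = v'\<close> is used too: it says that a loop vertex lies on no digon.\<close>

lemma loop_detour:
  assumes "(v, v) \<in> E" "(v', v') \<in> E" "(v, w) \<in> E" "(w, v') \<in> E"
  shows "v = w"
  using loop_walks[OF assms(1), of "[v, v, w, v']" "[v, w, v', v']"] assms
  by (simp add: arc_walk_def)

text \<open>Otherwise \<open>v, w, w'\<close> and \<open>v, v, w'\<close> would form a diamond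
  starting at the loop.\<close>

lemma loop_out_independent:
  assumes "(v, v) \<in> E" "(v, w) \<in> E" "(v, w') \<in> E" "w \<noteq> v"
  shows "(w, w') \<notin> E"
  using diamond_from[of "{v}" v w w' v] assms k by auto

lemma loop_in_independent:
  assumes "(v, v) \<in> E" "(w, v) \<in> E" "(w', v) \<in> E" "w' \<noteq> v"
  shows "(w, w') \<notin> E"
  using diamond_to[of "{v}" v w w' v] assms k by auto

text \<open>A single loop is settled by its neighbourhood alone. For \<open>p \<ge> 2\<close> loops
  the number of missing pairs plus \<open>3 * p + 2\<close> is at least
  \<open>p * p + 2 * card V\<close>, and \<open>(p - 2) * (p - 3) \<ge> 0\<close> finishes. This
  bound comes from one loop and an extra missing pair, or, if loop vertices are adjacent to all
  other vertices, from the independence of \<open>R\<close>.\<close>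

lemma loop_deficit:
  assumes V: "finite V" "E \<subseteq> V \<times> V" "6 \<le> card V" and ne: "loop_vertices E \<noteq> {}"
  shows "2 * card (loop_vertices E) + 4 \<le> card (nonadjacent V E)"
proof -
  define L where "L = loop_vertices E"
  define R where "R = V - L"
  define p where "p = card L"
  have loop: "(v, v) \<in> E" if "v \<in> L" for v using that by (simp add: L_def loop_vertices_def)
  have LV: "L \<subseteq> V" using V(2) by (auto simp: L_def loop_vertices_def)
  have fin: "finite L" "finite R" using LV V(1) finite_subset by (auto simp: R_def)
  have cR: "card R + p = card V"
    using LV fin V(1) card_Diff_subset[of L V] card_mono[of V L] by (simp add: R_def p_def)
  have finN: "finite (nonadjacent V E)" using V(1) by (rule finite_nonadjacent)
  have LN: "L \<times> L - Id \<subseteq> nonadjacent V E"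
    using loops_nonadjacent loop LV by (auto simp: nonadjacent_def)
  have cL: "card (L \<times> L - Id) + p = p * p" using card_off_diagonal[OF fin(1)] by (simp add: p_def)
  \<comment> \<open>No pair in \<open>X\<close> joins \<open>R\<close> to a loop vertex other than
    \<open>v\<close>; this leaves room for the extra missing pair.\<close>
  have star: "\<exists>X. X \<subseteq> nonadjacent V E \<and> X \<inter> (L - {v}) \<times> R = {} \<and> X \<inter> R \<times> (L - {v}) = {} \<and>
      p * p + 2 * card R \<le> card X + p + 4" if v: "v \<in> L" for v
  proof -
    define P where "P = {w \<in> R. (v, w) \<in> E}"
    define Q where "Q = {w \<in> R. (w, v) \<in> E}"
    define N where "N = R - P - Q"
    have vR: "v \<notin> R" using v by (simp add: R_def)
    have PQ: "P \<inter> Q = {}"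
      using loop_detour[OF loop[OF v] loop[OF v]] vR by (auto simp: P_def Q_def)
    have finPQ: "finite P" "finite Q" "finite N" using fin by (auto simp: P_def Q_def N_def)
    have "card R = card P + card (Q \<union> N)"
      using fin PQ by (intro card_eq_disjoint_union) (auto simp: P_def Q_def N_def)
    moreover have "card (Q \<union> N) = card Q + card N"
      using finPQ by (intro card_Un_disjoint) (auto simp: N_def)
    ultimately have cR': "card R = card P + card Q + card N" by simp
    define X where "X = (L \<times> L - Id) \<union> ((P \<times> P - Id) \<union> ((Q \<times> Q - Id) \<union> (N \<times> {v} \<union> {v} \<times> N)))"
    have "P \<times> P - Id \<subseteq> nonadjacent V E"
      using loop_out_independent[OF loop[OF v]] vR by (auto simp: P_def R_def nonadjacent_def)
    moreover have "Q \<times> Q - Id \<subseteq> nonadjacent V E"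
      using loop_in_independent[OF loop[OF v]] vR by (auto simp: Q_def R_def nonadjacent_def)
    moreover have "N \<times> {v} \<union> {v} \<times> N \<subseteq> nonadjacent V E"
      using v LV vR by (auto simp: N_def P_def Q_def R_def nonadjacent_def)
    ultimately have XN: "X \<subseteq> nonadjacent V E" using LN by (auto simp: X_def)
    have "card (N \<times> {v} \<union> {v} \<times> N) = card N + card N"
      using finPQ vR by (subst card_Un_disjoint) (auto simp: N_def card_cartesian_product)
    moreover have "card ((Q \<times> Q - Id) \<union> (N \<times> {v} \<union> {v} \<times> N))
        = card (Q \<times> Q - Id) + card (N \<times> {v} \<union> {v} \<times> N)"
      using finPQ vR by (intro card_Un_disjoint) (auto simp: N_def Q_def)
    moreover have "card ((P \<times> P - Id) \<union> ((Q \<times> Q - Id) \<union> (N \<times> {v} \<union> {v} \<times> N)))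
        = card (P \<times> P - Id) + card ((Q \<times> Q - Id) \<union> (N \<times> {v} \<union> {v} \<times> N))"
      using finPQ vR PQ by (intro card_Un_disjoint) (auto simp: N_def Q_def P_def)
    moreover have "card X = card (L \<times> L - Id)
        + card ((P \<times> P - Id) \<union> ((Q \<times> Q - Id) \<union> (N \<times> {v} \<union> {v} \<times> N)))"
      unfolding X_def using finPQ fin vR
      by (intro card_Un_disjoint) (auto simp: N_def Q_def P_def R_def)
    ultimately have "p * p + 2 * card R \<le> card X + p + 4"
      using cL card_off_diagonal_ge[OF finPQ(1)] card_off_diagonal_ge[OF finPQ(2)] cR' by linarith
    moreover have "X \<inter> (L - {v}) \<times> R = {}" "X \<inter> R \<times> (L - {v}) = {}"
      by (auto simp: X_def P_def Q_def N_def R_def)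
    ultimately show ?thesis using XN by blast
  qed
  have quadratic: "5 * p \<le> p * p + 6"
  proof -
    have "0 \<le> (int p - 2) * (int p - 3)" by (cases "p \<le> 2") (auto simp: zero_le_mult_iff)
    then have "int (5 * p) \<le> int (p * p + 6)" by (simp add: algebra_simps)
    then show ?thesis by (simp only: of_nat_le_iff)
  qed
  have "2 * p + 4 \<le> card (nonadjacent V E)"
  proof (cases "p = 1")
    case True
    obtain v where "v \<in> L" using ne by (auto simp: L_def)
    from star[OF this] obtain X where X: "X \<subseteq> nonadjacent V E"
        "p * p + 2 * card R \<le> card X + p + 4" by blast
    show ?thesis using X(2) card_mono[OF finN X(1)] True cR V(3) by simp
  next
    case p1: False
    show ?thesis
    proof (cases "\<exists>u\<in>L. \<exists>w\<in>R. (u, w) \<notin> E \<and> (w, u) \<notin> E")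
      case True
      then obtain u w where u: "u \<in> L" "w \<in> R" "(u, w) \<notin> E" "(w, u) \<notin> E" by blast
      have "L - {u} \<noteq> {}"
      proof
        assume "L - {u} = {}"
        then have "L = {u}" using u by blast
        then show False using p1 by (simp add: p_def)
      qed
      \<comment> \<open>The star is taken at a loop vertex other than \<open>u\<close>, so its pairs
        do not include \<open>u\<close> with \<open>w\<close>.\<close>
      then obtain v where v: "v \<in> L" "v \<noteq> u" by blast
      obtain X where X: "X \<subseteq> nonadjacent V E" "X \<inter> (L - {v}) \<times> R = {}" "X \<inter> R \<times> (L - {v}) = {}"
          "p * p + 2 * card R \<le> card X + p + 4"
        using star[OF v(1)] by blast
      have uw: "u \<noteq> w" "u \<in> V" "w \<in> V" using u LV by (auto simp: R_def)
      have "(u, w) \<notin> X" "(w, u) \<notin> X" using X(2,3) u v by blast+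
      moreover have "finite X" using X(1) finN finite_subset by blast
      ultimately have "card (insert (u, w) (insert (w, u) X)) = card X + 2" using uw by simp
      moreover have "insert (u, w) (insert (w, u) X) \<subseteq> nonadjacent V E"
        using X(1) u uw by (auto simp: nonadjacent_def)
      ultimately have "card X + 2 \<le> card (nonadjacent V E)" using finN card_mono by metis
      then show ?thesis using X(4) cR V(3) quadratic by linarith
    next
      case False
      have adj: "(u, w) \<in> E \<or> (w, u) \<in> E" if "u \<in> L" "w \<in> R" for u w using False that by blast
      obtain v v' where v: "v \<in> L" "v' \<in> L" "v \<noteq> v'"
      proof -
        have "\<not> L \<subseteq> {u}" if "u \<in> L" for u
        proof
          assume "L \<subseteq> {u}"
          then have "L = {u}" using that by blast
          then show False using p1 by (simp add: p_def)
        qed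
        then show thesis using that ne unfolding L_def by blast
      qed
      \<comment> \<open>Each vertex of \<open>R\<close> is an out-neighbour of both \<open>v\<close>
        and \<open>v'\<close> or an in-neighbour of both. The two kinds cannot coexist by
        \<open>through_unique\<close>, and within one kind the loop at \<open>v\<close> forbids
        arcs.\<close>
      have "(w, w') \<notin> E" if w: "w \<in> R" "w' \<in> R" for w w'
      proof
        assume ww: "(w, w') \<in> E"
        have wv: "w \<noteq> v" "w' \<noteq> v" "w \<noteq> v'" "w' \<noteq> v'" using w v by (auto simp: R_def)
        have type: "(v, x) \<in> E \<and> (v', x) \<in> E \<or> (x, v) \<in> E \<and> (x, v') \<in> E" if "x \<in> R" for x
        proof -
          have "x \<noteq> v" "x \<noteq> v'" using that v by (auto simp: R_def)
          then show ?thesis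
            using adj[OF v(1) that] adj[OF v(2) that] loop_detour[of v v' x] loop_detour[of v' v x]
              loop v by blast
        qed
        have S: "\<forall>s\<in>{v, v'}. \<exists>t\<in>{v, v'}. (s, t) \<in> E" using loop v by blast
        have thr: False if "(v, y) \<in> E" "(v', y) \<in> E" "(x, v) \<in> E" "(x, v') \<in> E" for x y
          using through_unique[OF S, of y v v' x] that v k by auto
        show False
          using type[OF w(1)] type[OF w(2)] loop_out_independent[OF loop[OF v(1)], of w w']
            loop_in_independent[OF loop[OF v(1)], of w w'] thr ww wv by blast
      qed
      then have "R \<times> R - Id \<subseteq> nonadjacent V E" by (auto simp: nonadjacent_def R_def)
      then have "card ((L \<times> L - Id) \<union> (R \<times> R - Id)) \<le> card (nonadjacent V E)"
        using LN finN by (intro card_mono) auto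
      moreover have "card ((L \<times> L - Id) \<union> (R \<times> R - Id)) = card (L \<times> L - Id) + card (R \<times> R - Id)"
        using fin by (intro card_Un_disjoint) (auto simp: R_def)
      ultimately show ?thesis
        using cL card_off_diagonal_ge[OF fin(2)] cR V(3) quadratic by linarith
    qed
  qed
  then show ?thesis by (simp add: p_def L_def)
qed

end

end

section \<open>Missing pairs and longer cycles\<close>

lemma nonadjacent_sym: "(x, y) \<in> nonadjacent V E \<Longrightarrow> (y, x) \<in> nonadjacent V E"
  by (auto simp: nonadjacent_def)

text \<open>Consequently fewer than four ordered pairs mean at most one missing adjacency.\<close>

lemma nonadjacent_two_pairs:
  assumes "finite V" "(x, y) \<in> nonadjacent V E" "(z, w) \<in> nonadjacent V E" "{x, y} \<noteq> {z, w}"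
  shows "4 \<le> card (nonadjacent V E)"
proof -
  have "x \<noteq> y" "z \<noteq> w" using assms(2,3) by (auto simp: nonadjacent_def)
  then have "card {(x, y), (y, x), (z, w), (w, z)} = 4"
    using assms(4) by (auto simp: card_insert_if)
  moreover have "{(x, y), (y, x), (z, w), (w, z)} \<subseteq> nonadjacent V E"
    using assms(2,3) nonadjacent_sym[of _ _ V E] by simp
  ultimately show ?thesis using card_mono[OF finite_nonadjacent[OF assms(1)]] by metis
qed

text \<open>On a shortest cycle \<open>x, a, b, c, ...\<close> the arcs from \<open>x\<close> to
  \<open>b\<close> and from \<open>a\<close> to \<open>c\<close> would be shortcuts, and the
  reversed arcs would close triangles. So both chords are missing.\<close>

lemma long_cycle_deficit:
  assumes V: "finite V" "E \<subseteq> V \<times> V" and cyc: "\<not> acyclic E"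
    and asym: "\<And>x y. (x, y) \<in> E \<Longrightarrow> (y, x) \<notin> E"
    and tri: "\<And>x y z. \<lbrakk>(x, y) \<in> E; (y, z) \<in> E\<rbrakk> \<Longrightarrow> (z, x) \<notin> E"
  shows "4 \<le> card (nonadjacent V E)"
proof -
  \<comment> \<open>Closed walks are diagonal elements of relation powers; the least positive
    exponent is the length of a shortest cycle.\<close>
  let ?P = "\<lambda>m. 0 < m \<and> (\<exists>x. (x, x) \<in> E ^^ m)"
  define m where "m = (LEAST m. ?P m)"
  have "\<exists>m. ?P m" using cyc by (auto simp: acyclic_def trancl_power)
  then have "?P m" unfolding m_def by (rule LeastI_ex)
  then obtain x where x: "0 < m" "(x, x) \<in> E ^^ m" by blast
  have least: "\<not> ?P j" if "j < m" for j using that not_less_Least unfolding m_def by blast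
  obtain m1 where m1: "m = Suc m1" using x(1) by (cases m) auto
  obtain a where a: "(x, a) \<in> E" "(a, x) \<in> E ^^ m1"
    using x(2) relpow_Suc_D2[of x x m1 E] unfolding m1 by blast
  have "m1 \<noteq> 0" using a asym[of x a] by (cases m1) auto
  then obtain m2 where m2: "m1 = Suc m2" by (cases m1) auto
  obtain b where b: "(a, b) \<in> E" "(b, x) \<in> E ^^ m2"
    using a(2) relpow_Suc_D2[of a x m2 E] unfolding m2 by blast
  have "m2 \<noteq> 0" using a(1) b asym[of x a] by (cases m2) auto
  then obtain m3 where m3: "m2 = Suc m3" by (cases m2) auto
  obtain c where c: "(b, c) \<in> E" "(c, x) \<in> E ^^ m3"
    using b(2) relpow_Suc_D2[of b x m3 E] unfolding m3 by blast
  have "m3 \<noteq> 0" using a(1) b(1) c tri[of x a b] by (cases m3) auto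
  then obtain j where m: "m = Suc (Suc (Suc (Suc j)))" "m3 = Suc j" using m1 m2 m3 by (cases m3) auto
  note b = b[unfolded m3 m(2)] and c = c[unfolded m(2)]
  \<comment> \<open>A shortcut would produce a closed walk of length \<open>m - 1\<close>.\<close>
  have short: "(x, x) \<notin> E ^^ Suc (Suc (Suc j))" using least[of "Suc (Suc (Suc j))"] m(1) by blast
  have "(x, b) \<notin> E" using b(2) short relpow_Suc_I2 by metis
  moreover have "(a, c) \<notin> E" using a(1) c(2) short relpow_Suc_I2 by metis
  moreover have "(b, x) \<notin> E" "(c, a) \<notin> E" using tri a(1) b(1) c(1) by blast+
  moreover have "x \<noteq> b" "a \<noteq> c" using asym a(1) b(1) c(1) by blast+
  moreover have "x \<in> V" "a \<in> V" "b \<in> V" "c \<in> V" using V(2) a(1) b(1) c(1) by auto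
  ultimately have "(x, b) \<in> nonadjacent V E" "(a, c) \<in> nonadjacent V E"
    by (auto simp: nonadjacent_def)
  moreover have "x \<noteq> a" "x \<noteq> c" using asym tri a(1) b(1) c(1) by blast+
  then have "{x, b} \<noteq> {a, c}" by auto
  ultimately show ?thesis using nonadjacent_two_pairs[OF V(1)] by blast
qed

section \<open>Triangles without loops and digons\<close>

context unique_walks
begin

lemma triangle_diamond_from:
  assumes "2 \<le> k" "(a, b) \<in> E" "(b, c) \<in> E" "(c, a) \<in> E" "x \<in> {a, b, c}"
    and "(x, p) \<in> E" "(p, y) \<in> E" "(x, q) \<in> E" "(q, y) \<in> E"
  shows "p = q"
proof (rule diamond_from[OF _ assms(5,1,6-9)])
  show "\<forall>s\<in>{a, b, c}. \<exists>t\<in>{a, b, c}. (t, s) \<in> E" using assms(2-4) by blast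
qed

lemma triangle_diamond_to:
  assumes "2 \<le> k" "(a, b) \<in> E" "(b, c) \<in> E" "(c, a) \<in> E" "y \<in> {a, b, c}"
    and "(x, p) \<in> E" "(p, y) \<in> E" "(x, q) \<in> E" "(q, y) \<in> E"
  shows "p = q"
proof (rule diamond_to[OF _ assms(5,1,6-9)])
  show "\<forall>s\<in>{a, b, c}. \<exists>t\<in>{a, b, c}. (s, t) \<in> E" using assms(2-4) by blast
qed

context
  fixes V :: "'a set"
  assumes k: "2 \<le> k" and V: "finite V" "6 \<le> card V" "E \<subseteq> V \<times> V"
    and asym: "\<And>x y. (x, y) \<in> E \<Longrightarrow> (y, x) \<notin> E"
    and few: "card (nonadjacent V E) < 4"
begin

lemma missing_pair_unique:
  assumes "(x, y) \<in> nonadjacent V E" "(z, w) \<in> nonadjacent V E"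
  shows "z = x \<and> w = y \<or> z = y \<and> w = x"
  using nonadjacent_two_pairs[OF V(1) assms] few by (auto simp: doubleton_eq_iff)

text \<open>A detour via \<open>w\<close> would make \<open>a\<close>, \<open>w\<close> the only
  missing pair, so a fifth vertex \<open>u\<close> is adjacent to all of \<open>a\<close>,
  \<open>b\<close>, \<open>c\<close>, \<open>w\<close>. Diamonds then exclude both directions
  between \<open>u\<close> and \<open>w\<close>.\<close>

lemma triangle_no_detour:
  assumes tri: "(a, b) \<in> E" "(b, c) \<in> E" "(c, a) \<in> E"
    and w: "w \<in> V" "w \<noteq> a" "w \<noteq> b" "w \<noteq> c" and bw: "(b, w) \<in> E"
  shows "(w, c) \<notin> E"
proof
  assume wc: "(w, c) \<in> E"
  note from_tri = triangle_diamond_from[OF k tri]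
  note to_tri = triangle_diamond_to[OF k tri]
  have abc: "a \<in> V" "b \<in> V" "c \<in> V" "a \<noteq> b" "a \<noteq> c" "b \<noteq> c" using V(3) tri asym by auto
  have "(a, w) \<notin> E" using from_tri[of a w c b] wc tri w by auto
  moreover have "(w, a) \<notin> E" using from_tri[of b w a c] bw tri w by auto
  ultimately have miss: "(a, w) \<in> nonadjacent V E" using abc w by (auto simp: nonadjacent_def)
  have "\<not> V \<subseteq> {a, b, c, w}"
  proof
    assume "V \<subseteq> {a, b, c, w}"
    then have "card V \<le> card {a, b, c, w}" by (intro card_mono) auto
    also have "\<dots> \<le> 4" by (simp add: card_insert_if)
    finally show False using V(2) by simp
  qed
  then obtain u where u: "u \<in> V" "u \<noteq> a" "u \<noteq> b" "u \<noteq> c" "u \<noteq> w" by blast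
  have adj: "(u, t) \<in> E \<or> (t, u) \<in> E" if "t \<in> {a, b, c, w}" for t
  proof (rule ccontr)
    assume "\<not> ?thesis"
    then have "(u, t) \<in> nonadjacent V E" using that u w abc by (auto simp: nonadjacent_def)
    from missing_pair_unique[OF miss this] show False using u by auto
  qed
  have "\<not> ((a, u) \<in> E \<and> (u, c) \<in> E)" using from_tri[of a u c b] tri u by auto
  moreover have "\<not> ((b, u) \<in> E \<and> (u, a) \<in> E)" using from_tri[of b u a c] tri u by auto
  moreover have "\<not> ((c, u) \<in> E \<and> (u, b) \<in> E)" using from_tri[of c u b a] tri u by auto
  \<comment> \<open>Following the three exclusions around the triangle, one arc from it to
    \<open>u\<close> forces all three.\<close>
  ultimately consider "(a, u) \<in> E" "(b, u) \<in> E" "(c, u) \<in> E"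
    | "(u, a) \<in> E" "(u, b) \<in> E" "(u, c) \<in> E"
    using adj[of a] adj[of b] adj[of c] by blast
  then show False
  proof cases
    case 1
    have "(w, u) \<notin> E" using from_tri[of b w u c] 1 bw tri w by auto
    moreover have "(u, w) \<notin> E" using from_tri[of a u w b] 1 bw tri u by auto
    ultimately show False using adj[of w] by simp
  next
    case 2
    have "(u, w) \<notin> E" using to_tri[of c u w b] 2 wc tri w by auto
    moreover have "(w, u) \<notin> E" using to_tri[of a w u c] 2 wc tri u by auto
    ultimately show False using adj[of w] by simp
  qed
qed

text \<open>Each of three further vertices only sends arcs to the triangle or only receives arcs
  from it. Two of the same kind are nonadjacent; three of one kind give too many missing pairs, and
  both kinds together allow walks through the triangle.\<close>

lemma no_triangle:
  assumes tri: "(a, b) \<in> E" "(b, c) \<in> E" "(c, a) \<in> E"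
  shows False
proof -
  note from_tri = triangle_diamond_from[OF k tri]
  note to_tri = triangle_diamond_to[OF k tri]
  have abc: "a \<in> V" "b \<in> V" "c \<in> V" "a \<noteq> b" "a \<noteq> c" "b \<noteq> c" using V(3) tri asym by auto
  define W where "W = V - {a, b, c}"
  define src where "src w \<longleftrightarrow> (a, w) \<notin> E \<and> (b, w) \<notin> E \<and> (c, w) \<notin> E" for w
  define snk where "snk w \<longleftrightarrow> (w, a) \<notin> E \<and> (w, b) \<notin> E \<and> (w, c) \<notin> E" for w
  have "3 \<le> card W"
    using V abc card_Diff_subset[of "{a, b, c}" V] by (simp add: W_def)
  then obtain W' where "W' \<subseteq> W" "card W' = 3" by (meson obtain_subset_with_card_n)
  then obtain u v w where uvw: "u \<in> W" "v \<in> W" "w \<in> W" "u \<noteq> v" "u \<noteq> w" "v \<noteq> w"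
    by (auto simp: card_3_iff)
  have one_way: "src x \<or> snk x" if "x \<in> W" for x
  proof -
    have x: "x \<in> V" "x \<noteq> a" "x \<noteq> b" "x \<noteq> c" using that by (auto simp: W_def)
    have "\<not> ((a, x) \<in> E \<and> (x, c) \<in> E)" using from_tri[of a x c b] tri x by auto
    moreover have "\<not> ((b, x) \<in> E \<and> (x, a) \<in> E)" using from_tri[of b x a c] tri x by auto
    moreover have "\<not> ((c, x) \<in> E \<and> (x, b) \<in> E)" using from_tri[of c x b a] tri x by auto
    moreover have "(b, x) \<in> E \<Longrightarrow> (x, c) \<notin> E"
      by (rule triangle_no_detour[OF tri x])
    moreover have "(c, x) \<in> E \<Longrightarrow> (x, a) \<notin> E"
      using triangle_no_detour[OF tri(2,3,1), of x] x by blast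
    moreover have "(a, x) \<in> E \<Longrightarrow> (x, b) \<notin> E"
      using triangle_no_detour[OF tri(3,1,2), of x] x by blast
    ultimately show ?thesis using asym unfolding src_def snk_def by blast
  qed
  have na: "(t, x) \<in> nonadjacent V E" if "x \<in> W" "t \<in> {a, b, c}" "(t, x) \<notin> E" "(x, t) \<notin> E" for t x
    using that abc by (auto simp: nonadjacent_def W_def)
  have snks: "(x, y) \<notin> E" if xy: "x \<in> W" "y \<in> W" "snk x" "snk y" for x y
  proof
    assume e: "(x, y) \<in> E"
    then have "x \<noteq> y" using asym by blast
    have x: "x \<noteq> a" "x \<noteq> b" "x \<noteq> c" using xy by (auto simp: W_def)
    have "(a, x) \<notin> E \<or> (b, y) \<notin> E" "(b, x) \<notin> E \<or> (c, y) \<notin> E"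
      using from_tri[of a x y b] from_tri[of b x y c] e tri x by auto
    \<comment> \<open>The pairs offered by the first disjunction differ from those offered by the
      second, so two adjacencies are missing.\<close>
    then have "(a, x) \<in> nonadjacent V E \<or> (b, y) \<in> nonadjacent V E"
        "(b, x) \<in> nonadjacent V E \<or> (c, y) \<in> nonadjacent V E"
      using na xy unfolding snk_def by blast+
    moreover have "x \<notin> {a, b, c}" "y \<notin> {a, b, c}" using xy by (auto simp: W_def)
    ultimately show False
      using missing_pair_unique[of a x b x] missing_pair_unique[of a x c y]
        missing_pair_unique[of b y b x] missing_pair_unique[of b y c y] abc \<open>x \<noteq> y\<close> by blast
  qed
  have srcs: "(x, y) \<notin> E" if xy: "x \<in> W" "y \<in> W" "src x" "src y" for x y
  proof
    assume e: "(x, y) \<in> E"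
    then have "x \<noteq> y" using asym by blast
    have y: "y \<noteq> a" "y \<noteq> b" "y \<noteq> c" using xy by (auto simp: W_def)
    have "(x, a) \<notin> E \<or> (y, b) \<notin> E" "(x, b) \<notin> E \<or> (y, c) \<notin> E"
      using to_tri[of b x a y] to_tri[of c x b y] e tri y by auto
    then have "(a, x) \<in> nonadjacent V E \<or> (b, y) \<in> nonadjacent V E"
        "(b, x) \<in> nonadjacent V E \<or> (c, y) \<in> nonadjacent V E"
      using na xy unfolding src_def by blast+
    moreover have "x \<notin> {a, b, c}" "y \<notin> {a, b, c}" using xy by (auto simp: W_def)
    ultimately show False
      using missing_pair_unique[of a x b x] missing_pair_unique[of a x c y]
        missing_pair_unique[of b y b x] missing_pair_unique[of b y c y] abc \<open>x \<noteq> y\<close> by blast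
  qed
  have same: "(x, y) \<in> nonadjacent V E"
    if "x \<in> W" "y \<in> W" "x \<noteq> y" "src x \<and> src y \<or> snk x \<and> snk y" for x y
    using that snks srcs by (auto simp: nonadjacent_def W_def)
  \<comment> \<open>The only missing pair is \<open>p\<close>, \<open>q\<close>, so the triangle is
    fully joined to \<open>W\<close>, and walks from \<open>x\<close> to \<open>y\<close> can enter
    it at \<open>a\<close> or at \<open>b\<close>.\<close>
  have mixed: False if x: "x \<in> W" "src x" and y: "y \<in> W" "snk y"
    and pq: "p \<in> W" "q \<in> W" "p \<noteq> q" "src p \<and> src q \<or> snk p \<and> snk q" for x y p q
  proof -
    have miss: "(p, q) \<in> nonadjacent V E" using same[OF pq] .
    have full: "(t, z) \<in> E \<or> (z, t) \<in> E" if "t \<in> {a, b, c}" "z \<in> W" for t z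
    proof (rule ccontr)
      assume "\<not> ?thesis"
      then have "(t, z) \<in> nonadjacent V E" using na that by blast
      from missing_pair_unique[OF miss this] show False using that pq by (auto simp: W_def)
    qed
    have "(x, a) \<in> E" "(x, b) \<in> E" "\<forall>t\<in>{a, b, c}. (t, y) \<in> E"
      using full x y unfolding src_def snk_def by blast+
    moreover have "\<forall>s\<in>{a, b, c}. \<exists>t\<in>{a, b, c}. (s, t) \<in> E" using tri by blast
    ultimately have "a = b" using through_unique[of "{a, b, c}" y a b x] k by blast
    then show False using abc by simp
  qed
  have three: False if "src u \<and> src v \<and> src w \<or> snk u \<and> snk v \<and> snk w"
    using missing_pair_unique[OF same[OF uvw(1,2,4)] same[OF uvw(1,3,5)]] that uvw by blast
  show False
    using one_way[OF uvw(1)] one_way[OF uvw(2)] one_way[OF uvw(3)] three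
      mixed[OF _ _ _ _ uvw(1,2,4)] mixed[OF _ _ _ _ uvw(1,3,5)] mixed[OF _ _ _ _ uvw(2,3,6)]
      uvw(1-3) by blast
qed

end

text \<open>The digon bound already includes the loops, so loops are treated next, in the absence of
  digons. What remains has neither, and four missing ordered pairs suffice.\<close>

lemma cycle_deficit:
  assumes k: "4 \<le> k" and V: "finite V" "E \<subseteq> V \<times> V" "6 \<le> card V" and cyc: "\<not> acyclic E"
  shows "2 * card (loop_vertices E) + card (digons E) + 4 \<le> card (nonadjacent V E)"
proof (cases "digons E = {}")
  case False
  then show ?thesis using digon_deficit[OF k V] by simp
next
  case D: True
  show ?thesis
  proof (cases "loop_vertices E = {}")
    case False
    then show ?thesis using loop_deficit[OF k V] D by simp
  next
    case L: True
    have asym: "(y, x) \<notin> E" if "(x, y) \<in> E" for x y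
      using that L D by (auto simp: loop_vertices_def digons_def)
    have "4 \<le> card (nonadjacent V E)"
    proof (rule ccontr)
      assume "\<not> ?thesis"
      then have few: "card (nonadjacent V E) < 4" by simp
      have "(z, x) \<notin> E" if "(x, y) \<in> E" "(y, z) \<in> E" for x y z
        using no_triangle[of V x y z] k V asym few that by auto
      from long_cycle_deficit[OF V(1,2) cyc asym this] show False using few by simp
    qed
    then show ?thesis using L D by simp
  qed
qed

end

section \<open>Transitive tournaments without one arc\<close>

text \<open>Induction strips off a vertex without incoming arcs. Only \<open>V\<close> shrinks, so
  \<open>E\<close> is restricted to \<open>V \<times> V\<close> before choosing a minimal
  element.\<close>

lemma topological_enumeration:
  assumes "finite V" "acyclic E"
  shows "\<exists>vs. distinct vs \<and> set vs = V \<and> sorted_wrt (\<lambda>x y. (y, x) \<notin> E) vs"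
  using assms(1)
proof (induction "card V" arbitrary: V)
  case 0
  then show ?case by (intro exI[of _ "[]"]) simp
next
  case (Suc m)
  have "wf (E \<inter> V \<times> V)"
    using Suc.prems assms(2) by (intro finite_acyclic_wf) (auto intro: acyclic_subset)
  moreover have "V \<noteq> {}" using Suc.hyps(2) by auto
  ultimately obtain z where z: "z \<in> V" "\<And>y. (y, z) \<in> E \<inter> V \<times> V \<Longrightarrow> y \<notin> V"
    by (metis wfE_min')
  have m: "m = card (V - {z})" "finite (V - {z})" using Suc.hyps(2) Suc.prems z(1) by simp_all
  obtain vs where vs: "distinct vs" "set vs = V - {z}" "sorted_wrt (\<lambda>x y. (y, x) \<notin> E) vs"
    using Suc.hyps(1)[OF m] by blast
  have "\<forall>y\<in>V - {z}. (y, z) \<notin> E" using z by blast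
  then show ?case using vs z(1) by (intro exI[of _ "z # vs"]) (simp add: insert_absorb)
qed

text \<open>Indices start at 0: \<open>p = 0\<close> is the pattern of \<open>K'_mat\<close>, and
  \<open>p = n - 2\<close> that of \<open>K_mat\<close>.\<close>

definition near_transitive :: "'a list \<Rightarrow> nat \<Rightarrow> ('a \<times> 'a) set \<Rightarrow> bool" where
  "near_transitive vs p E \<longleftrightarrow> distinct vs \<and> Suc p < length vs \<and>
     (\<forall>i < length vs. \<forall>j < length vs. (vs ! i, vs ! j) \<in> E \<longleftrightarrow> i < j \<and> (i, j) \<noteq> (p, Suc p))"

lemma near_transitive_count:
  assumes nt: "near_transitive vs p E" and E: "E \<subseteq> set vs \<times> set vs"
  shows "2 * card E + length vs + 2 = length vs * length vs"
proof -
  have d: "distinct vs" and p: "Suc p < length vs"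
    and arc: "\<And>i j. \<lbrakk>i < length vs; j < length vs\<rbrakk> \<Longrightarrow>
      (vs ! i, vs ! j) \<in> E \<longleftrightarrow> i < j \<and> (i, j) \<noteq> (p, Suc p)"
    using nt by (auto simp: near_transitive_def)
  have "loop_vertices E = {}"
  proof -
    have False if xx: "(x, x) \<in> E" for x
    proof -
      have "x \<in> set vs" using xx E by blast
      then obtain i where "i < length vs" "x = vs ! i" by (metis in_set_conv_nth)
      then show False using xx arc[of i i] by simp
    qed
    then show ?thesis by (auto simp: loop_vertices_def)
  qed
  moreover have "digons E = {}"
  proof -
    have False if xy: "(x, y) \<in> E" "(y, x) \<in> E" for x y
    proof -
      have "x \<in> set vs" "y \<in> set vs" using xy E by blast+
      then obtain i j where "i < length vs" "x = vs ! i" "j < length vs" "y = vs ! j"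
        by (metis in_set_conv_nth)
      then show False using xy arc[of i j] arc[of j i] by simp
    qed
    then show ?thesis by (auto simp: digons_def)
  qed
  moreover have "nonadjacent (set vs) E = {(vs ! p, vs ! Suc p), (vs ! Suc p, vs ! p)}"
  proof (intro equalityI subsetI)
    fix e assume e: "e \<in> nonadjacent (set vs) E"
    obtain i j where ij: "e = (vs ! i, vs ! j)" "i < length vs" "j < length vs"
      using e by (auto simp: nonadjacent_def in_set_conv_nth)
    then have "i \<noteq> j" "(vs ! i, vs ! j) \<notin> E" "(vs ! j, vs ! i) \<notin> E"
      using e by (auto simp: nonadjacent_def)
    then have "i = p \<and> j = Suc p \<or> j = p \<and> i = Suc p"
      using arc[OF ij(2,3)] arc[OF ij(3,2)] by (cases i j rule: linorder_cases) simp_all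
    then show "e \<in> {(vs ! p, vs ! Suc p), (vs ! Suc p, vs ! p)}" using ij by auto
  next
    fix e assume "e \<in> {(vs ! p, vs ! Suc p), (vs ! Suc p, vs ! p)}"
    then show "e \<in> nonadjacent (set vs) E"
      using p arc[of p "Suc p"] arc[of "Suc p" p] d
      by (auto simp: nonadjacent_def nth_eq_iff_index_eq)
  qed
  moreover have "vs ! p \<noteq> vs ! Suc p" using d p by (simp add: nth_eq_iff_index_eq)
  ultimately show ?thesis using arcs_count[of "set vs" E] E d by (simp add: distinct_card)
qed

lemma strict_sorted_fills_interval:
  fixes xs :: "nat list"
  assumes "sorted_wrt (<) xs" "set xs \<subseteq> {a..<b}" "length xs = b - a"
  shows "xs = [a..<b]"
proof -
  have "sorted xs" "distinct xs" using assms(1) by (simp_all add: strict_sorted_iff)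
  moreover have "set xs = {a..<b}"
    using assms(2,3) \<open>distinct xs\<close> by (intro card_subset_eq) (simp_all add: distinct_card)
  ultimately show ?thesis by (intro sorted_distinct_set_unique) simp_all
qed

text \<open>A walk of length \<open>n - 2\<close> visits all but one vertex. If one of the two ends of the order has its
  consecutive arc removed, then the omitted vertex is one of the two at that end.\<close>

lemma near_transitive_unique_walks:
  assumes nt: "near_transitive vs p E" and E: "E \<subseteq> set vs \<times> set vs"
    and n: "length vs = n" "3 \<le> n" and p: "p = 0 \<or> p = n - 2"
  shows "unique_walks E (n - 2)"
proof
  have d: "distinct vs"
    and arc: "\<And>i j. \<lbrakk>i < n; j < n\<rbrakk> \<Longrightarrow> (vs ! i, vs ! j) \<in> E \<longleftrightarrow> i < j \<and> (i, j) \<noteq> (p, Suc p)"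
    using nt n by (auto simp: near_transitive_def)
  \<comment> \<open>Arcs increase the index, so a walk becomes a strictly increasing index
    list.\<close>
  have index_list: "\<exists>is. q = map ((!) vs) is \<and> sorted_wrt (<) is \<and> set is \<subseteq> {..<n} \<and>
      length is = n - 1 \<and> (\<forall>i. Suc i < length is \<longrightarrow> (is ! i, is ! Suc i) \<noteq> (p, Suc p))"
    if q: "arc_walk E q" "length q = Suc (n - 2)" for q
  proof -
    have step: "(q ! i, q ! Suc i) \<in> E" if "Suc i < length q" for i
      using q(1) that by (simp add: arc_walk_def successively_conv_nth)
    have "q ! i \<in> set vs" if "i < length q" for i
    proof (cases "Suc i < length q")
      case True
      then show ?thesis using step[of i] E by auto
    next
      case False
      then have "i = Suc (i - 1)" using that q(2) n(2) by simp
      then show ?thesis using step[of "i - 1"] that E by auto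
    qed
    then have "\<forall>i<length q. \<exists>j<n. q ! i = vs ! j" using n(1) by (metis in_set_conv_nth)
    then obtain f where f: "\<And>i. i < length q \<Longrightarrow> f i < n \<and> q ! i = vs ! f i" by metis
    have lt: "f i < f (Suc i) \<and> (f i, f (Suc i)) \<noteq> (p, Suc p)" if "Suc i < length q" for i
      using step[OF that] f[of i] f[OF that] that arc[of "f i" "f (Suc i)"] by simp
    let ?is = "map f [0..<length q]"
    have "q = map ((!) vs) ?is" using f by (intro nth_equalityI) simp_all
    moreover have "successively (<) ?is" using lt by (simp add: successively_conv_nth)
    then have "sorted_wrt (<) ?is" by (simp add: successively_conv_sorted_wrt)
    moreover have "(?is ! i, ?is ! Suc i) \<noteq> (p, Suc p)" if "Suc i < length ?is" for i
      using lt[of i] that by simp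
    moreover have "set ?is \<subseteq> {..<n}" "length ?is = n - 1" using f q(2) n(2) by auto
    ultimately show ?thesis by blast
  qed
  fix q r
  assume q: "arc_walk E q" "length q = Suc (n - 2)" and r: "arc_walk E r" "length r = Suc (n - 2)"
    and ends: "hd q = hd r" "last q = last r"
  have ne: "q \<noteq> []" "r \<noteq> []" using q r by auto
  from p show "q = r"
  proof
    assume p: "p = 0"
    have "tl s = map ((!) vs) [2..<n]" if s: "arc_walk E s" "length s = Suc (n - 2)" for s
    proof -
      obtain "is" where "is": "s = map ((!) vs) is" "sorted_wrt (<) is" "set is \<subseteq> {..<n}"
          "length is = n - 1" "\<And>i. Suc i < length is \<Longrightarrow> (is ! i, is ! Suc i) \<noteq> (p, Suc p)"
        using index_list[OF s] by blast
      obtain j js where j: "is = j # js" using "is"(4) n(2) by (cases "is") auto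
      \<comment> \<open>Index 1 could be second only after index 0, and this arc is missing. Hence
        the \<open>n - 2\<close> later indices fill \<open>[2..<n]\<close>.\<close>
      have "2 \<le> x" if "x \<in> set js" for x
      proof -
        obtain l ls where l: "js = l # ls" using \<open>x \<in> set js\<close> by (cases js) auto
        have "j < l" "l \<le> x" using "is"(2) that unfolding j l by auto
        moreover have "(j, l) \<noteq> (0, 1)" using "is"(5)[of 0] p unfolding j l by simp
        ultimately show ?thesis by auto
      qed
      then have "js = [2..<n]"
        using "is"(2-4) n(2) unfolding j by (intro strict_sorted_fills_interval) auto
      then show ?thesis using "is"(1) j by simp
    qed
    then have "tl q = tl r" using q r by simp
    then show ?thesis using ends(1) ne by (metis list.collapse)
  next
    assume p: "p = n - 2"
    have "butlast s = map ((!) vs) [0..<n - 2]" if s: "arc_walk E s" "length s = Suc (n - 2)" for s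
    proof -
      obtain "is" where "is": "s = map ((!) vs) is" "sorted_wrt (<) is" "set is \<subseteq> {..<n}"
          "length is = n - 1" "\<And>i. Suc i < length is \<Longrightarrow> (is ! i, is ! Suc i) \<noteq> (p, Suc p)"
        using index_list[OF s] by blast
      have "is \<noteq> []" using "is"(4) n(2) by auto
      then obtain js l where j: "is = js @ [l]" by (metis rev_exhaust)
      \<comment> \<open>Mirror image: index \<open>n - 2\<close> could be followed only by
        \<open>n - 1\<close>, and this arc is missing.\<close>
      have "x < n - 2" if "x \<in> set js" for x
      proof -
        obtain ms m where m: "js = ms @ [m]" using \<open>x \<in> set js\<close> by (metis empty_iff empty_set rev_exhaust)
        have "m < l" "x \<le> m" "l < n" using "is"(2,3) that unfolding j m by (auto simp: sorted_wrt_append)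
        moreover have "(m, l) \<noteq> (n - 2, Suc (n - 2))"
          using "is"(5)[of "length ms"] p unfolding j m by (simp add: nth_append)
        ultimately show ?thesis by auto
      qed
      then have "js = [0..<n - 2]"
        using "is"(2,4) n(2) unfolding j
        by (intro strict_sorted_fills_interval) (auto simp: sorted_wrt_append)
      then show ?thesis using "is"(1) j by (simp add: butlast_append)
    qed
    then have "butlast q = butlast r" using q r by simp
    then show ?thesis using ends(2) ne by (metis append_butlast_last_id)
  qed
qed

context unique_walks
begin

text \<open>The walks through all but one inner vertex of the order compete with one another.\<close>

lemma missing_arc_at_end:
  assumes d: "distinct vs" and n: "length vs = n" "6 \<le> n" and k: "k = n - 2"
    and arc: "\<And>i j. \<lbrakk>i < j; j < n; (i, j) \<noteq> (p, q)\<rbrakk> \<Longrightarrow> (vs ! i, vs ! j) \<in> E"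
  shows "q = Suc p \<and> (p = 0 \<or> p = n - 2)"
proof -
  define skip where "skip s = map ((!) vs) ([0..<s] @ [Suc s..<n])" for s
  \<comment> \<open>The only jump is from \<open>s - 1\<close> to \<open>Suc s\<close>. A missing
    consecutive arc is avoided by omitting one of its ends; for \<open>n \<le> q\<close> no arc is
    missing.\<close>
  have walk: "arc_walk E (skip s)"
    if s: "0 < s" "Suc s < n" "(p, q) \<noteq> (s - 1, Suc s)" "q \<noteq> Suc p \<or> p = s \<or> Suc p = s \<or> n \<le> q"
    for s
  proof -
    have "successively (\<lambda>i j. (vs ! i, vs ! j) \<in> E) [0..<s]"
      using s by (auto simp: successively_conv_nth intro!: arc)
    moreover have "successively (\<lambda>i j. (vs ! i, vs ! j) \<in> E) [Suc s..<n]"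
      using s by (auto simp: successively_conv_nth intro!: arc)
    moreover have "(vs ! (s - 1), vs ! Suc s) \<in> E" using s by (intro arc) auto
    moreover have "last [0..<s] = s - 1" "hd [Suc s..<n] = Suc s" using s by simp_all
    ultimately have "successively (\<lambda>i j. (vs ! i, vs ! j) \<in> E) ([0..<s] @ [Suc s..<n])"
      by (simp only: successively_append_iff) simp
    then show ?thesis using s by (simp add: arc_walk_def skip_def successively_map del: map_append)
  qed
  have compete: "s = t"
    if "0 < s" "Suc s < n" "0 < t" "Suc t < n" "arc_walk E (skip s)" "arc_walk E (skip t)" for s t
  proof -
    have ends: "hd (skip s) = vs ! 0 \<and> last (skip s) = vs ! (n - 1) \<and> length (skip s) = Suc k"
      if "0 < s" "Suc s < n" for s
      using that k by (auto simp: skip_def hd_append last_append hd_map last_map)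
    have "skip s = skip t"
      using that ends[of s] ends[of t] by (intro unique) simp_all
    moreover have "vs ! s \<notin> set (skip s)"
      using that d n(1) by (auto simp: skip_def nth_eq_iff_index_eq)
    moreover have "vs ! s \<in> set (skip t)" if "s \<noteq> t"
    proof -
      have "s \<in> {0..<t} \<union> {Suc t..<n}" using that \<open>Suc s < n\<close> by auto
      then show ?thesis unfolding skip_def by (simp del: Un_iff add: image_Un[symmetric])
    qed
    ultimately show ?thesis by metis
  qed
  have "q = Suc p"
  proof (rule ccontr)
    assume "q \<noteq> Suc p"
    \<comment> \<open>A missing nonconsecutive arc can spoil only the jump over
      \<open>Suc p\<close>, so two of the indices 1, 2, 3 still compete.\<close>
    then have *: "arc_walk E (skip s)" if "0 < s" "Suc s < n" "s \<noteq> Suc p" for s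
      using that by (intro walk) auto
    show False
      using compete[of 1 2] compete[of 1 3] compete[of 2 3] *[of 1] *[of 2] *[of 3] n(2)
      by (cases "p = 0"; cases "p = 1") auto
  qed
  moreover have "p = 0 \<or> p = n - 2"
  proof (rule ccontr)
    assume p: "\<not> ?thesis"
    show False
    proof (cases "Suc p < n")
      case True
      then have "Suc (Suc p) < n" "0 < p" using p by arith+
      then show False using compete[of p "Suc p"] walk[of p] walk[of "Suc p"] \<open>q = Suc p\<close> by auto
    next
      \<comment> \<open>Now \<open>q\<close> is out of range and the tournament is complete.\<close>
      case False
      then have "arc_walk E (skip s)" if "0 < s" "s \<le> 2" for s
        using that \<open>q = Suc p\<close> n(2) by (intro walk) auto
      then show False using compete[of 1 2] n(2) by simp
    qed
  qed
  ultimately show ?thesis by simp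
qed

text \<open>The near-transitive case has \<open>2 * card E + n + 2 = n * n\<close>, so the first
  alternative is at least one arc below it.\<close>

lemma extremal_dichotomy:
  assumes V: "finite V" "E \<subseteq> V \<times> V" "card V = n" and n: "6 \<le> n" and k: "k = n - 2"
  shows "2 * card E + n + 4 \<le> n * n \<or>
    (\<exists>vs p. set vs = V \<and> near_transitive vs p E \<and> (p = 0 \<or> p = n - 2))"
proof (cases "acyclic E")
  case False
  then have "2 * card (loop_vertices E) + card (digons E) + 4 \<le> card (nonadjacent V E)"
    using V n k by (intro cycle_deficit) auto
  then show ?thesis using arcs_count[OF V(1,2)] V(3) by simp
next
  case acyc: True
  have asym: "(y, x) \<notin> E" if "(x, y) \<in> E" for x y
    using acyc that trancl_into_trancl[of x y E x] by (auto simp: acyclic_def)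
  then have "loop_vertices E = {}" "digons E = {}" by (auto simp: loop_vertices_def digons_def)
  then have count: "2 * card E + card (nonadjacent V E) + n = n * n"
    using arcs_count[OF V(1,2)] V(3) by simp
  show ?thesis
  proof (cases "4 \<le> card (nonadjacent V E)")
    case True
    then show ?thesis using count by simp
  next
    case few: False
    obtain vs where vs: "distinct vs" "set vs = V" "sorted_wrt (\<lambda>x y. (y, x) \<notin> E) vs"
      using topological_enumeration[OF V(1) acyc] by blast
    have len: "length vs = n" using vs V(3) distinct_card by metis
    have no_back: "(vs ! j, vs ! i) \<notin> E" if "i \<le> j" "j < n" for i j
      using that vs(3) len asym[of "vs ! i" "vs ! i"]
      by (cases "i = j") (auto simp: sorted_wrt_iff_nth_less)
    have miss: "(vs ! i, vs ! j) \<in> nonadjacent V E" if "i < j" "j < n" "(vs ! i, vs ! j) \<notin> E" for i j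
      using that no_back[of i j] vs len by (auto simp: nonadjacent_def nth_eq_iff_index_eq)
    have "\<exists>p q. \<forall>i j. i < j \<longrightarrow> j < n \<longrightarrow> (i, j) \<noteq> (p, q) \<longrightarrow> (vs ! i, vs ! j) \<in> E"
    proof (cases "\<exists>p q. p < q \<and> q < n \<and> (vs ! p, vs ! q) \<notin> E")
      case True
      then obtain p q where pq: "p < q" "q < n" "(vs ! p, vs ! q) \<notin> E" by blast
      have "(vs ! i, vs ! j) \<in> E" if ij: "i < j" "j < n" "(i, j) \<noteq> (p, q)" for i j
      proof (rule ccontr)
        assume "(vs ! i, vs ! j) \<notin> E"
        then have "{vs ! p, vs ! q} = {vs ! i, vs ! j}"
          using nonadjacent_two_pairs[OF V(1) miss[OF pq] miss[OF ij(1,2)]] few by auto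
        then show False
          using ij pq vs(1) len by (auto simp: doubleton_eq_iff nth_eq_iff_index_eq)
      qed
      then show ?thesis by blast
    next
      case False
      then show ?thesis by blast
    qed
    then obtain p q where arc: "\<And>i j. \<lbrakk>i < j; j < n; (i, j) \<noteq> (p, q)\<rbrakk> \<Longrightarrow> (vs ! i, vs ! j) \<in> E"
      by blast
    have pq: "q = Suc p" "p = 0 \<or> p = n - 2"
      using missing_arc_at_end[OF vs(1) len n k arc] by blast+
    \<comment> \<open>For a complete tournament the pair \<open>(0, 0)\<close> excludes no arc, but
      it does not satisfy \<open>q = Suc p\<close>.\<close>
    have "(vs ! p, vs ! Suc p) \<notin> E"
    proof
      assume e: "(vs ! p, vs ! Suc p) \<in> E"
      have "(vs ! i, vs ! j) \<in> E" if "i < j" "j < n" for i j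
        using arc[of i j] that e pq(1) by (cases "(i, j) = (p, q)") auto
      then show False using missing_arc_at_end[OF vs(1) len n k, of 0 0] by blast
    qed
    then have "(vs ! i, vs ! j) \<in> E \<longleftrightarrow> i < j \<and> (i, j) \<noteq> (p, Suc p)" if "i < n" "j < n" for i j
      using that arc[of i j] no_back[of j i] pq(1) by (cases "i < j") auto
    moreover have "Suc p < n" using pq(2) n by auto
    ultimately have "near_transitive vs p E"
      unfolding near_transitive_def using vs(1) len by simp
    then show ?thesis using vs(2) pq(2) by blast
  qed
qed

end

section \<open>Adjacency matrices\<close>

lemma set_vwalk_arcs_subset:
  "set (vwalk_arcs p) \<subseteq> E \<longleftrightarrow> successively (\<lambda>x y. (x, y) \<in> E) p"
  by (induction p rule: vwalk_arcs.induct) auto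

text \<open>As the length is positive, each vertex of a walk is an end of an arc and thus lies in
  \<open>pverts D\<close>.\<close>

lemma F_free_iff_unique_walks:
  assumes E: "parcs D \<subseteq> pverts D \<times> pverts D" and k: "1 \<le> k"
  shows "F_free k D \<longleftrightarrow> unique_walks (parcs D) k"
proof -
  have verts: "set p \<subseteq> pverts D" if "arc_walk (parcs D) p" "length p = Suc k" for p
  proof -
    have step: "(p ! i, p ! Suc i) \<in> parcs D" if "Suc i < length p" for i
      using \<open>arc_walk (parcs D) p\<close> that by (simp add: arc_walk_def successively_conv_nth)
    have "p ! i \<in> pverts D" if "i < length p" for i
    proof (cases "Suc i < length p")
      case True
      then show ?thesis using step[of i] E by auto
    next
      case False
      then have "i = Suc (i - 1)" using that \<open>length p = Suc k\<close> k by simp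
      then show ?thesis using step[of "i - 1"] that E by auto
    qed
    then show ?thesis by (auto simp: in_set_conv_nth)
  qed
  have walk_iff: "walk_of_length D k u v p \<longleftrightarrow>
      arc_walk (parcs D) p \<and> length p = Suc k \<and> hd p = u \<and> last p = v" for u v p
  proof
    assume "walk_of_length D k u v p"
    then show "arc_walk (parcs D) p \<and> length p = Suc k \<and> hd p = u \<and> last p = v"
      by (cases p) (auto simp: walk_of_length_def vwalk_def set_vwalk_arcs_subset arc_walk_def)
  next
    assume p: "arc_walk (parcs D) p \<and> length p = Suc k \<and> hd p = u \<and> last p = v"
    then show "walk_of_length D k u v p"
      using verts[of p]
      by (simp add: walk_of_length_def vwalk_def set_vwalk_arcs_subset arc_walk_def)
  qed
  have ends: "hd p \<in> pverts D \<and> last p \<in> pverts D"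
    if "arc_walk (parcs D) p" "length p = Suc k" for p
    using verts[OF that] that(2) by (cases "p = []") auto
  show ?thesis
  proof
    assume free: "F_free k D"
    show "unique_walks (parcs D) k"
    proof
      fix p q
      assume "arc_walk (parcs D) p" "length p = Suc k" "arc_walk (parcs D) q" "length q = Suc k"
        "hd p = hd q" "last p = last q"
      then show "p = q" using free ends[of q] unfolding F_free_def walk_iff by blast
    qed
  next
    assume "unique_walks (parcs D) k"
    then interpret unique_walks "parcs D" k .
    show "F_free k D" unfolding F_free_def walk_iff by (auto intro: unique)
  qed
qed

lemma permutation_mat_conjugate:
  assumes A: "A \<in> carrier_mat n n" and s: "s permutes {..<n}"
  shows "permutation_mat n s * A * transpose_mat (permutation_mat n s)
    = mat n n (\<lambda>(i, j). A $$ (s i, s j))"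
proof (rule eq_matI)
  have P: "permutation_mat n s \<in> carrier_mat n n" by (simp add: permutation_mat_def)
  fix i j assume "i < dim_row (mat n n (\<lambda>(i, j). A $$ (s i, s j)))"
    and "j < dim_col (mat n n (\<lambda>(i, j). A $$ (s i, s j)))"
  then have ij: "i < n" "j < n" by simp_all
  have sn: "s i < n" if "i < n" for i using permutes_in_image[OF s, of i] that by simp
  have left: "(permutation_mat n s * A) $$ (i, l) = A $$ (s i, l)" if "i < n" "l < n" for i l
  proof -
    have "(permutation_mat n s * A) $$ (i, l) = (\<Sum>m\<in>{0..<n}. (if m = s i then 1 else 0) * A $$ (m, l))"
      using that A by (auto simp: permutation_mat_def scalar_prod_def intro!: sum.cong)
    also have "\<dots> = (\<Sum>m\<in>{0..<n}. if m = s i then A $$ (m, l) else 0)"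
      by (intro sum.cong) auto
    also have "\<dots> = A $$ (s i, l)" using sn[OF that(1)] by simp
    finally show ?thesis .
  qed
  have "(permutation_mat n s * A * transpose_mat (permutation_mat n s)) $$ (i, j)
      = (\<Sum>m\<in>{0..<n}. (permutation_mat n s * A) $$ (i, m) * (if m = s j then 1 else 0))"
    using ij A P by (auto simp: permutation_mat_def scalar_prod_def intro!: sum.cong)
  also have "\<dots> = (\<Sum>m\<in>{0..<n}. if m = s j then A $$ (s i, m) else 0)"
    using left ij by (intro sum.cong) auto
  also have "\<dots> = A $$ (s i, s j)" using sn[OF ij(2)] by simp
  finally show "(permutation_mat n s * A * transpose_mat (permutation_mat n s)) $$ (i, j)
      = mat n n (\<lambda>(i, j). A $$ (s i, s j)) $$ (i, j)" using ij by simp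
qed (use A in \<open>simp_all add: permutation_mat_def\<close>)

text \<open>Conjugation reorders the enumeration of the vertices, and any two enumerations of one
  set differ by a permutation.\<close>

lemma permutation_similar_adjacency_mat:
  assumes "distinct vs"
  shows "permutation_similar (adjacency_mat vs D) M \<longleftrightarrow>
    (\<exists>us. distinct us \<and> set us = set vs \<and> M = adjacency_mat us D)"
proof -
  let ?A = "adjacency_mat vs D" and ?n = "length vs"
  have A: "?A \<in> carrier_mat ?n ?n" by (simp add: adjacency_mat_def)
  have conj: "permutation_mat ?n s * ?A * transpose_mat (permutation_mat ?n s)
      = adjacency_mat (permute_list s vs) D" if s: "s permutes {..<?n}" for s
  proof -
    have "s i < ?n" if "i < ?n" for i using permutes_in_image[OF s, of i] that by simp
    then show ?thesis
      unfolding permutation_mat_conjugate[OF A s]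
      by (intro eq_matI) (simp_all add: adjacency_mat_def permute_list_nth[OF s])
  qed
  have "(\<exists>s. s permutes {..<?n} \<and> M = adjacency_mat (permute_list s vs) D) \<longleftrightarrow>
    (\<exists>us. distinct us \<and> set us = set vs \<and> M = adjacency_mat us D)"
  proof
    assume "\<exists>s. s permutes {..<?n} \<and> M = adjacency_mat (permute_list s vs) D"
    then show "\<exists>us. distinct us \<and> set us = set vs \<and> M = adjacency_mat us D"
      using assms by (metis distinct_permute_list set_permute_list)
  next
    assume "\<exists>us. distinct us \<and> set us = set vs \<and> M = adjacency_mat us D"
    then obtain us where us: "distinct us" "set us = set vs" "M = adjacency_mat us D" by blast
    then have "mset us = mset vs" using assms by (simp add: set_eq_iff_mset_eq_distinct)
    then obtain s where "s permutes {..<?n}" "permute_list s vs = us" by (rule mset_eq_permutation)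
    then show "\<exists>s. s permutes {..<?n} \<and> M = adjacency_mat (permute_list s vs) D" using us by blast
  qed
  then show ?thesis
    using conj by (auto simp: permutation_similar_def adjacency_mat_def)
qed

text \<open>The 2 by 2 zero block leaves one zero above the diagonal, at the last two indices here
  and at the first two in \<open>K'_mat\<close>.\<close>

lemma K_mat_eq:
  assumes "2 \<le> n"
  shows "K_mat n = mat n n (\<lambda>(i, j). if i < j \<and> (i, j) \<noteq> (n - 2, Suc (n - 2)) then 1 else 0)"
  using assms by (intro eq_matI) (auto simp: K_mat_def T_mat_def J_mat_def)

lemma K'_mat_eq:
  assumes "2 \<le> n"
  shows "K'_mat n = mat n n (\<lambda>(i, j). if i < j \<and> (i, j) \<noteq> (0, Suc 0) then 1 else 0)"
  using assms by (intro eq_matI) (auto simp: K'_mat_def T_mat_def J_mat_def)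

lemma adjacency_mat_eq_near_transitive:
  assumes "distinct vs" "Suc p < n"
  shows "adjacency_mat vs D = mat n n (\<lambda>(i, j). if i < j \<and> (i, j) \<noteq> (p, Suc p) then 1 else 0) \<longleftrightarrow>
    length vs = n \<and> near_transitive vs p (parcs D)"
proof
  assume eq: "adjacency_mat vs D = mat n n (\<lambda>(i, j). if i < j \<and> (i, j) \<noteq> (p, Suc p) then 1 else 0)"
  have "dim_row (adjacency_mat vs D) = n" unfolding eq by simp
  then have n: "length vs = n" by (simp add: adjacency_mat_def)
  have "(vs ! i, vs ! j) \<in> parcs D \<longleftrightarrow> i < j \<and> (i, j) \<noteq> (p, Suc p)" if "i < n" "j < n" for i j
  proof -
    have "adjacency_mat vs D $$ (i, j) = (if i < j \<and> (i, j) \<noteq> (p, Suc p) then 1 else 0)"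
      unfolding eq using that by simp
    then show ?thesis using that n by (auto simp: adjacency_mat_def split: if_splits)
  qed
  then show "length vs = n \<and> near_transitive vs p (parcs D)"
    using n assms by (simp add: near_transitive_def)
next
  assume "length vs = n \<and> near_transitive vs p (parcs D)"
  then show "adjacency_mat vs D = mat n n (\<lambda>(i, j). if i < j \<and> (i, j) \<noteq> (p, Suc p) then 1 else 0)"
    by (intro eq_matI) (auto simp: adjacency_mat_def near_transitive_def)
qed

lemma permutation_similar_near_transitive:
  assumes "distinct vs" "Suc p < n"
  shows "permutation_similar (adjacency_mat vs D)
      (mat n n (\<lambda>(i, j). if i < j \<and> (i, j) \<noteq> (p, Suc p) then 1 else 0)) \<longleftrightarrow>
    (\<exists>us. set us = set vs \<and> length us = n \<and> near_transitive us p (parcs D))"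
proof -
  have "distinct us \<and> set us = set vs \<and>
      mat n n (\<lambda>(i, j). if i < j \<and> (i, j) \<noteq> (p, Suc p) then 1 else 0) = adjacency_mat us D \<longleftrightarrow>
      set us = set vs \<and> length us = n \<and> near_transitive us p (parcs D)" for us
  proof (cases "distinct us")
    case True
    then show ?thesis
      unfolding eq_commute[of _ "adjacency_mat us D"]
      using adjacency_mat_eq_near_transitive[OF True assms(2), of D] by blast
  next
    case False
    then show ?thesis by (simp add: near_transitive_def)
  qed
  then show ?thesis unfolding permutation_similar_adjacency_mat[OF assms(1)] by simp
qed

section \<open>The extremal digraphs\<close>

lemma F_free_digraphs_walks:
  assumes "D \<in> F_free_digraphs n (n - 2)" "6 \<le> n"
  shows "finite (pverts D)" "parcs D \<subseteq> pverts D \<times> pverts D" "card (pverts D) = n"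
    and "unique_walks (parcs D) (n - 2)"
proof -
  interpret pair_fin_digraph D using assms(1) by (simp add: F_free_digraphs_def)
  show fin: "finite (pverts D)" by (rule pair_finite_verts)
  show E: "parcs D \<subseteq> pverts D \<times> pverts D" using in_arcsD1 in_arcsD2 by auto
  show "card (pverts D) = n" using assms(1) by (simp add: F_free_digraphs_def)
  show "unique_walks (parcs D) (n - 2)"
    using assms F_free_iff_unique_walks[OF E, of "n - 2"] by (simp add: F_free_digraphs_def)
qed

lemma near_transitive_F_free:
  assumes D: "pair_fin_digraph D" and n: "6 \<le> n"
    and vs: "length vs = n" "set vs = pverts D" "near_transitive vs p (parcs D)" "p = 0 \<or> p = n - 2"
  shows "D \<in> F_free_digraphs n (n - 2)" "2 * card (parcs D) + n + 2 = n * n"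
proof -
  interpret pair_fin_digraph D by fact
  have E: "parcs D \<subseteq> pverts D \<times> pverts D" using in_arcsD1 in_arcsD2 by auto
  have "unique_walks (parcs D) (n - 2)"
    using near_transitive_unique_walks[OF vs(3)] E vs n by simp
  moreover have "card (pverts D) = n"
    using vs by (metis distinct_card near_transitive_def)
  ultimately show "D \<in> F_free_digraphs n (n - 2)"
    using F_free_iff_unique_walks[OF E, of "n - 2"] n D by (simp add: F_free_digraphs_def)
  show "2 * card (parcs D) + n + 2 = n * n"
    using near_transitive_count[OF vs(3)] E vs by simp
qed

lemma F_free_digraphs_dichotomy:
  assumes "D \<in> F_free_digraphs n (n - 2)" "6 \<le> n"
  shows "2 * card (parcs D) + n + 4 \<le> n * n \<or>
    (\<exists>vs p. set vs = pverts D \<and> length vs = n \<and> near_transitive vs p (parcs D) \<and> (p = 0 \<or> p = n - 2))"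
proof -
  note D = F_free_digraphs_walks[OF assms]
  interpret unique_walks "parcs D" "n - 2" by (rule D(4))
  have "length vs = n" if "set vs = pverts D" "near_transitive vs p (parcs D)" for vs p
    using that D(3) by (metis distinct_card near_transitive_def)
  then show ?thesis using extremal_dichotomy[OF D(1-3) assms(2) refl] by blast
qed

lemma F_free_digraphs_card:
  assumes "D \<in> F_free_digraphs n (n - 2)" "6 \<le> n"
  shows "2 * card (parcs D) + n + 2 \<le> n * n"
proof -
  have D: "pair_fin_digraph D" using assms(1) by (simp add: F_free_digraphs_def)
  have "2 * card (parcs D) + n + 2 = n * n"
    if "set vs = pverts D" "length vs = n" "near_transitive vs p (parcs D)" "p = 0 \<or> p = n - 2"
    for vs p
    using near_transitive_F_free(2)[OF D assms(2)] that by blast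
  then show ?thesis using F_free_digraphs_dichotomy[OF assms] by fastforce
qed

lemma ex_F_value:
  assumes n: "6 \<le> n"
  shows "2 * ex_F n (n - 2) + n + 2 = n * n"
proof -
  let ?S = "F_free_digraphs n (n - 2) :: nat pair_pre_digraph set"
  \<comment> \<open>The digraph of \<open>K'_mat n\<close>, which attains the bound.\<close>
  define D :: "nat pair_pre_digraph" where
    "D = \<lparr> pverts = {0..<n}, parcs = {(i, j). i < j \<and> j < n \<and> (i, j) \<noteq> (0, 1)} \<rparr>"
  have "parcs D \<subseteq> {0..<n} \<times> {0..<n}" by (auto simp: D_def)
  then have "finite (parcs D)" by (rule finite_subset) simp
  then have fin: "pair_fin_digraph D"
    by unfold_locales (auto simp: D_def)
  have nt: "near_transitive [0..<n] 0 (parcs D)"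
    using n by (auto simp: near_transitive_def D_def)
  have "length [0..<n] = n" "set [0..<n] = pverts D" by (simp_all add: D_def)
  note D = near_transitive_F_free[OF fin n this nt disjI1[OF refl]]
  have le: "card (parcs D') \<le> card (parcs D)" if "D' \<in> ?S" for D'
    using F_free_digraphs_card[OF that n] D(2) by linarith
  \<comment> \<open>\<open>Max\<close> needs a finite set. There are infinitely many digraphs on
    \<open>nat\<close>, but their arc counts are bounded.\<close>
  then have "(\<lambda>D. card (parcs D)) ` ?S \<subseteq> {..card (parcs D)}" by auto
  then have "finite ((\<lambda>D. card (parcs D)) ` ?S)" by (rule finite_subset) simp
  then have "ex_F n (n - 2) = card (parcs D)"
    unfolding ex_F_def using le D(1) by (intro Max_eqI) auto
  then show ?thesis using D(2) by simp
qed

theorem theorem7: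
  fixes n :: nat
  assumes "n \<ge> 6"
  shows "real (ex_F n (n - 2)) = real n * (real n - 1) / 2 - 1 \<and>
    (\<forall>(D :: 'a pair_pre_digraph) vs.
       pair_fin_digraph D \<and> distinct vs \<and> set vs = pverts D \<longrightarrow>
       (D \<in> Ex_F n (n - 2) \<longleftrightarrow>
          permutation_similar (adjacency_mat vs D) (K_mat n) \<or>
          permutation_similar (adjacency_mat vs D) (K'_mat n)))"
proof (intro conjI allI impI)
  have "2 * real (ex_F n (n - 2)) + real n + 2 = real n * real n"
    using arg_cong[OF ex_F_value[OF assms], of real] by simp
  then show "real (ex_F n (n - 2)) = real n * (real n - 1) / 2 - 1"
    by (simp add: algebra_simps)
next
  fix D :: "'a pair_pre_digraph" and vs
  assume "pair_fin_digraph D \<and> distinct vs \<and> set vs = pverts D"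
  then have D: "pair_fin_digraph D" and vs: "distinct vs" "set vs = pverts D" by simp_all
  have n: "2 \<le> n" "Suc (n - 2) < n" "Suc 0 < n" using assms by simp_all
  \<comment> \<open>Folding the entrywise forms turns both similarity conditions into
    \<open>near_transitive\<close> with \<open>p = n - 2\<close> and \<open>p = 0\<close>.\<close>
  note K = permutation_similar_near_transitive[OF vs(1) n(2), of D, folded K_mat_eq[OF n(1)]]
    permutation_similar_near_transitive[OF vs(1) n(3), of D, folded K'_mat_eq[OF n(1)]]
  have "D \<in> Ex_F n (n - 2) \<longleftrightarrow>
      (\<exists>us p. set us = pverts D \<and> length us = n \<and> near_transitive us p (parcs D) \<and>
        (p = 0 \<or> p = n - 2))"
  proof
    assume "D \<in> Ex_F n (n - 2)"
    then have "D \<in> F_free_digraphs n (n - 2)" "2 * card (parcs D) + n + 2 = n * n"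
      using ex_F_value[OF assms] by (simp_all add: Ex_F_def)
    then show "\<exists>us p. set us = pverts D \<and> length us = n \<and> near_transitive us p (parcs D) \<and>
        (p = 0 \<or> p = n - 2)"
      using F_free_digraphs_dichotomy[of D n] assms by auto
  next
    assume "\<exists>us p. set us = pverts D \<and> length us = n \<and> near_transitive us p (parcs D) \<and>
        (p = 0 \<or> p = n - 2)"
    then obtain us p where us: "length us = n" "set us = pverts D"
        "near_transitive us p (parcs D)" "p = 0 \<or> p = n - 2" by blast
    note extremal = near_transitive_F_free[OF D assms us]
    then have "card (parcs D) = ex_F n (n - 2)" using ex_F_value[OF assms] by linarith
    then show "D \<in> Ex_F n (n - 2)" using extremal(1) by (simp add: Ex_F_def)
  qed
  then show "D \<in> Ex_F n (n - 2) \<longleftrightarrow>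
      permutation_similar (adjacency_mat vs D) (K_mat n) \<or>
      permutation_similar (adjacency_mat vs D) (K'_mat n)" unfolding K vs(2) by blast
qed

end
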